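(* Let $r,n\ge1$, let $\Gamma\subset\mathbb{C}^\times$ be the cyclic group of $r$-th roots of unity and $\Gamma_n=\Gamma^n\rtimes S_n$. For any finite-dimensional graded $S_n$-module $M=\bigoplus_{d\ge0}M_d$ over $\mathbb{C}$ one has $$\mathrm{Frob}^\Gamma(\mathrm{Ind}(M);t)=\mathrm{Frob}(M;t^r)\big[X^{(0)}+tX^{(1)}+\dots+t^{r-1}X^{(r-1)}\big].$$
   Context: $t$ is the grading parameter. For a graded endomorphism $x$ of a finite-dimensional graded space $M=\bigoplus_d M_d$, $\mathrm{Tr}_M(x;t)=\sum_dt^d\,\mathrm{Tr}_{M_d}(x)$. **$S_n$.** $\mathrm{Frob}(M;t)=\frac1{n!}\sum_{w\in S_n}\mathrm{Tr}_M(w;t)\,p_{\tau(w)}$, where $\tau(w)$ is the cycle type of $w$ and $p_\lambda=p_{\lambda_1}p_{\lambda_2}\cdots$ is the power sum symmetric function; $\mathrm{Frob}(M;t^r)$ denotes the same expression with $t$ replaced by $t^r$. **The ring $\Lambda^\Gamma$.** Fix a generator $\zeta$ of $\Gamma$. $\Lambda^\Gamma=\Lambda^{\otimes r}$ over $\mathbb{C}[t]$, with tensor factors indexed by $0,\dots,r-1$ and alphabets $X^{(0)},\dots,X^{(r-1)}$; it is the polynomial ring over $\mathbb{C}[t]$ on $p^{(i)}_s=p_s[X^{(i)}]$, $0\le i<r$, $s\ge1$. A second set of generators $\hat p^{(i)}_s$ is defined by $p^{(j)}_s=r^{-1}\sum_{i=0}^{r-1}\zeta^{ij}\hat p^{(i)}_s$.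 (So $p^{(i)}_s$ corresponds to the irreducible character $\zeta\mapsto\zeta^i$ and $\hat p^{(i)}_s$ to the conjugacy class $\{\zeta^i\}$.) For an $r$-tuple of partitions $\lambda^\bullet$, $\hat p_{\lambda^\bullet}=\prod_i\hat p^{(i)}_{\lambda^{(i)}}$ with $\hat p^{(i)}_{\lambda^{(i)}}=\prod_k\hat p^{(i)}_{\lambda^{(i)}_k}$. **$\Gamma_n$.** For $g=(g_1,\dots,g_n,w)\in\Gamma_n$ and a cycle $C=(a\,b\cdots c)$ of $w$, put $g_C=g_ag_b\cdots g_c$; $C$ has color $i$ if $g_C=\zeta^i$, $0\le i<r$. The cycle type $\tau^\bullet(g)$ is the $r$-tuple of partitions where $\tau^{(i)}(g)$ lists the lengths of the cycles of $w$ of color $i$. For a finite-dimensional graded $\Gamma_n$-module $M$, $\mathrm{Frob}^\Gamma(M;t)=|\Gamma_n|^{-1}\sum_{g\in\Gamma_n}\mathrm{Tr}_M(g;t)\,\hat p_{\tau^\bullet(g)}\in\Lambda^\Gamma$. **Graded induction.** $\Gamma_n$ acts on $S=\mathbb{C}[x_1,\dots,x_n]$ (standard grading, $\deg x_k=1$) by algebra automorphisms $g\cdot x_k=g_{w(k)}x_{w(k)}$ for $g=(g_1,\dots,g_n,w)$. Let $S_{<r}\subset S$ be the graded $\Gamma_n$-submodule spanned by the monomials $x_1^{m_1}\cdots x_n^{m_n}$ with $0\le m_1,\dots,m_n<r$. For a finite-dimensional graded $S_n$-module $M$, $\mathrm{Ind}(M)=S_{<r}\otimes_{\mathbb{C}}\widetilde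 M$ (tensor product of graded $\Gamma_n$-modules), where $\widetilde M=M$ with $\Gamma_n$ acting through the projection $\Gamma_n\to S_n$ and with grading dilated by $r$: $\widetilde M_{rd}=M_d$ and $\widetilde{M}_{e}=0$ if $r\nmid e$. **Plethysm.** $f[X^{(0)}+tX^{(1)}+\dots+t^{r-1}X^{(r-1)}]$ is the image of $f$ under the $\mathbb{C}[t]$-algebra homomorphism $p_s\mapsto\sum_{i=0}^{r-1}t^{is}p^{(i)}_s$. *)

theory Defs
  imports
    Complex_Main
    "HOL-Library.Poly_Mapping"
    "HOL-Library.FuncSet"
    "HOL-Library.Multiset"
    "HOL-Computational_Algebra.Polynomial"
    "HOL-Combinatorics.Orbits"
    "HOL-Algebra.Multiplicative_Group"
    "HOL-Algebra.Sym_Groups"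
begin

section \<open>Complex vector spaces\<close>

class complex_vector = ab_group_add +
  fixes scaleC :: "complex \<Rightarrow> 'a \<Rightarrow> 'a"  (infixr \<open>*\<^sub>C\<close> 75)
  assumes scaleC_add_right: "c *\<^sub>C (x + y) = c *\<^sub>C x + c *\<^sub>C y"
    and scaleC_add_left: "(b + c) *\<^sub>C x = b *\<^sub>C x + c *\<^sub>C x"
    and scaleC_scaleC: "b *\<^sub>C c *\<^sub>C x = (b * c) *\<^sub>C x"
    and scaleC_one: "1 *\<^sub>C x = x"

global_interpretation complex_vector: vector_space "scaleC :: complex \<Rightarrow> 'a \<Rightarrow> 'a::complex_vector"
  by unfold_locales (simp_all add: scaleC_add_right scaleC_add_left scaleC_scaleC scaleC_one)

global_interpretation complex_vector: vector_space_pair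
  "scaleC :: complex \<Rightarrow> 'a \<Rightarrow> 'a::complex_vector" "scaleC :: complex \<Rightarrow> 'b \<Rightarrow> 'b::complex_vector"
  by unfold_locales

abbreviation clinear :: "('a::complex_vector \<Rightarrow> 'b::complex_vector) \<Rightarrow> bool" where
  "clinear \<equiv> Vector_Spaces.linear scaleC scaleC"

instantiation complex :: complex_vector
begin
definition scaleC_complex :: "complex \<Rightarrow> complex \<Rightarrow> complex" where
  [simp]: "scaleC_complex c x = c * x"
instance by standard (simp_all add: algebra_simps)
end

instantiation poly_mapping :: (type, complex_vector) complex_vector
begin
definition scaleC_poly_mapping :: "complex \<Rightarrow> ('a \<Rightarrow>\<^sub>0 'b) \<Rightarrow> 'a \<Rightarrow>\<^sub>0 'b" where
  "scaleC c x = Poly_Mapping.map (scaleC c) x"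

lemma lookup_scaleC: "Poly_Mapping.lookup (c *\<^sub>C x) k = c *\<^sub>C Poly_Mapping.lookup x k"
  for x :: "'a \<Rightarrow>\<^sub>0 'b"
  by (simp add: scaleC_poly_mapping_def map.rep_eq when_def complex_vector.scale_zero_right)

instance
  by standard
    (rule poly_mapping_eqI,
      simp add: lookup_scaleC lookup_add scaleC_add_right scaleC_add_left scaleC_scaleC scaleC_one)+
end

text \<open>The trace of an endomorphism \<^term>\<open>f\<close> of a finite-dimensional subspace \<^term>\<open>V\<close>, computed in an
  arbitrary basis; only the values of \<^term>\<open>f\<close> on \<^term>\<open>V\<close> matter.\<close>

definition trace_on :: "'a::complex_vector set \<Rightarrow> ('a \<Rightarrow> 'a) \<Rightarrow> complex" where
  "trace_on V f =
    (let B = (SOME B. B \<subseteq> V \<and> complex_vector.independent B \<and> complex_vector.span B = V)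
     in \<Sum>b\<in>B. complex_vector.representation B (f b) b)"


section \<open>Tensor products\<close>

text \<open>The quotient of the free vector space on pairs by the bilinearity relations.\<close>

definition tensor_relations :: "('a::complex_vector \<times> 'b::complex_vector \<Rightarrow>\<^sub>0 complex) set" where
  "tensor_relations =
     {Poly_Mapping.single (a + a', b) 1 - Poly_Mapping.single (a, b) 1 - Poly_Mapping.single (a', b) 1
        | a a' b. True} \<union>
     {Poly_Mapping.single (a, b + b') 1 - Poly_Mapping.single (a, b) 1 - Poly_Mapping.single (a, b') 1
        | a b b'. True} \<union>
     {Poly_Mapping.single (c *\<^sub>C a, b) 1 - c *\<^sub>C Poly_Mapping.single (a, b) 1 | c a b. True} \<union>
     {Poly_Mapping.single (a, c *\<^sub>C b) 1 - c *\<^sub>C Poly_Mapping.single (a, b) 1 | c a b. True}"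

definition tensor_rel ::
  "('a::complex_vector \<times> 'b::complex_vector \<Rightarrow>\<^sub>0 complex) \<Rightarrow> ('a \<times> 'b \<Rightarrow>\<^sub>0 complex) \<Rightarrow> bool" where
  "tensor_rel x y \<longleftrightarrow> x - y \<in> complex_vector.span tensor_relations"

lemma equivp_tensor_rel: "equivp tensor_rel"
proof (rule equivpI)
  show "reflp tensor_rel"
    by (auto simp: reflp_def tensor_rel_def complex_vector.span_zero)
  show "symp tensor_rel"
    unfolding symp_def tensor_rel_def by (metis complex_vector.span_neg minus_diff_eq)
  show "transp tensor_rel"
    unfolding transp_def tensor_rel_def
    using complex_vector.span_add by fastforce
qed

quotient_type (overloaded) ('a, 'b) tensor =
  "'a::complex_vector \<times> 'b::complex_vector \<Rightarrow>\<^sub>0 complex" / tensor_rel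
  by (rule equivp_tensor_rel)

instantiation tensor :: (complex_vector, complex_vector) complex_vector
begin

lift_definition zero_tensor :: "('a, 'b) tensor" is 0 .

lift_definition plus_tensor :: "('a, 'b) tensor \<Rightarrow> ('a, 'b) tensor \<Rightarrow> ('a, 'b) tensor" is "(+)"
  unfolding tensor_rel_def by (subst add_diff_add) (rule complex_vector.span_add)

lift_definition uminus_tensor :: "('a, 'b) tensor \<Rightarrow> ('a, 'b) tensor" is uminus
  unfolding tensor_rel_def by (subst minus_diff_minus) (rule complex_vector.span_neg)

lift_definition minus_tensor :: "('a, 'b) tensor \<Rightarrow> ('a, 'b) tensor \<Rightarrow> ('a, 'b) tensor" is "(-)"
proof -
  fix x x' y y' :: "'a \<times> 'b \<Rightarrow>\<^sub>0 complex"
  assume "tensor_rel x x'" "tensor_rel y y'"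
  then have "(x - x') - (y - y') \<in> complex_vector.span tensor_relations"
    unfolding tensor_rel_def by (rule complex_vector.span_diff)
  then show "tensor_rel (x - y) (x' - y')"
    unfolding tensor_rel_def by (simp add: algebra_simps)
qed

lift_definition scaleC_tensor :: "complex \<Rightarrow> ('a, 'b) tensor \<Rightarrow> ('a, 'b) tensor" is scaleC
  unfolding tensor_rel_def complex_vector.scale_right_diff_distrib[symmetric]
  by (rule complex_vector.span_scale)

instance
proof
  fix a b c :: "('a, 'b) tensor" and s t :: complex
  note refl = equivp_reflp[OF equivp_tensor_rel]
  show "a + b + c = a + (b + c)" by transfer (simp add: add.assoc refl)
  show "a + b = b + a" by transfer (simp add: add.commute refl)
  show "0 + a = a" by transfer (simp add: refl)
  show "- a + a = 0" by transfer (simp add: refl)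
  show "a - b = a + - b" by transfer (simp add: refl)
  show "s *\<^sub>C (a + b) = s *\<^sub>C a + s *\<^sub>C b" by transfer (simp add: scaleC_add_right refl)
  show "(s + t) *\<^sub>C a = s *\<^sub>C a + t *\<^sub>C a" by transfer (simp add: scaleC_add_left refl)
  show "s *\<^sub>C t *\<^sub>C a = (s * t) *\<^sub>C a" by transfer (simp add: scaleC_scaleC refl)
  show "1 *\<^sub>C a = a" by transfer (simp add: scaleC_one refl)
qed

end

lift_definition pure_tensor ::
  "'a::complex_vector \<Rightarrow> 'b::complex_vector \<Rightarrow> ('a, 'b) tensor"  (infixr \<open>\<otimes>\<^sub>t\<close> 72)
  is "\<lambda>a b. Poly_Mapping.single (a, b) 1" .

text \<open>The endomorphism of \<open>A \<otimes> B\<close> induced by linear maps \<^term>\<open>f\<close> on \<^term>\<open>A\<close> and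
  \<^term>\<open>g\<close> on \<^term>\<open>B\<close>. Its values are determined on the span of the pure tensors
  with factors in the subspaces \<^term>\<open>A\<close> and \<^term>\<open>B\<close>, and immaterial elsewhere.\<close>

definition tensor_map ::
  "'a::complex_vector set \<Rightarrow> 'b::complex_vector set \<Rightarrow> ('a \<Rightarrow> 'a) \<Rightarrow> ('b \<Rightarrow> 'b) \<Rightarrow>
    ('a, 'b) tensor \<Rightarrow> ('a, 'b) tensor" where
  "tensor_map A B f g = (SOME h. clinear h \<and> (\<forall>a\<in>A. \<forall>b\<in>B. h (a \<otimes>\<^sub>t b) = f a \<otimes>\<^sub>t g b))"

lemma pure_tensor_add_left: "(a + a') \<otimes>\<^sub>t b = a \<otimes>\<^sub>t b + a' \<otimes>\<^sub>t b"
  by transfer (unfold tensor_rel_def diff_diff_add [symmetric],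
    rule complex_vector.span_base, unfold tensor_relations_def, blast)

lemma pure_tensor_add_right: "a \<otimes>\<^sub>t (b + b') = a \<otimes>\<^sub>t b + a \<otimes>\<^sub>t b'"
  by transfer (unfold tensor_rel_def diff_diff_add [symmetric],
    rule complex_vector.span_base, unfold tensor_relations_def, blast)

lemma pure_tensor_scale_left: "(c *\<^sub>C a) \<otimes>\<^sub>t b = c *\<^sub>C (a \<otimes>\<^sub>t b)"
  by transfer (unfold tensor_rel_def, rule complex_vector.span_base, unfold tensor_relations_def, blast)

lemma pure_tensor_scale_right: "a \<otimes>\<^sub>t (c *\<^sub>C b) = c *\<^sub>C (a \<otimes>\<^sub>t b)"
  by transfer (unfold tensor_rel_def, rule complex_vector.span_base, unfold tensor_relations_def, blast)

definition free_lift :: "('p \<Rightarrow> 'v::complex_vector) \<Rightarrow> ('p \<Rightarrow>\<^sub>0 complex) \<Rightarrow> 'v" where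
  "free_lift F x = (\<Sum>p\<in>Poly_Mapping.keys x. Poly_Mapping.lookup x p *\<^sub>C F p)"

lemma free_lift_superset:
  "finite X \<Longrightarrow> Poly_Mapping.keys x \<subseteq> X \<Longrightarrow> free_lift F x = (\<Sum>p\<in>X. Poly_Mapping.lookup x p *\<^sub>C F p)"
  unfolding free_lift_def by (rule sum.mono_neutral_left) (auto simp: in_keys_iff)

lemma free_lift_single: "free_lift F (Poly_Mapping.single p c) = c *\<^sub>C F p"
  by (subst free_lift_superset[of "{p}"]) auto

lemma clinear_free_lift: "clinear (free_lift F)"
proof (unfold_locales)
  fix x y :: "'a \<Rightarrow>\<^sub>0 complex" and c :: complex
  let ?X = "Poly_Mapping.keys x \<union> Poly_Mapping.keys y"
  show "free_lift F (x + y) = free_lift F x + free_lift F y"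
    using Poly_Mapping.keys_add[of x y]
    by (simp add: free_lift_superset[of ?X] lookup_add scaleC_add_left sum.distrib)
  have "Poly_Mapping.keys (c *\<^sub>C x) \<subseteq> Poly_Mapping.keys x"
    by (auto simp: in_keys_iff lookup_scaleC)
  then show "free_lift F (c *\<^sub>C x) = c *\<^sub>C free_lift F x"
    by (simp add: free_lift_superset[of "Poly_Mapping.keys x"] lookup_scaleC
        complex_vector.scale_sum_right)
qed

lemma linear_on_extend:
  assumes A: "complex_vector.subspace A"
    and add: "\<And>x y. x \<in> A \<Longrightarrow> y \<in> A \<Longrightarrow> f (x + y) = f x + f y"
    and scale: "\<And>c x. x \<in> A \<Longrightarrow> f (c *\<^sub>C x) = c *\<^sub>C f x"
  shows "\<exists>h. clinear h \<and> (\<forall>x\<in>A. h x = f x)"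
proof -
  obtain B where B: "B \<subseteq> A" "complex_vector.independent B" "A \<subseteq> complex_vector.span B"
    using complex_vector.maximal_independent_subset by metis
  obtain h where h: "clinear h" "\<forall>x\<in>B. h x = f x"
    using complex_vector.linear_independent_extend[OF B(2)] by metis
  interpret h: Vector_Spaces.linear scaleC scaleC h by (fact h(1))
  have f0: "f 0 = 0" using scale[of 0 0] A by (simp add: complex_vector.subspace_0)
  have "x \<in> A \<and> h x = f x" if "x \<in> complex_vector.span B" for x
    using that
  proof (induction rule: complex_vector.span_induct_alt)
    case base then show ?case using A f0 by (simp add: complex_vector.subspace_0)
  next
    case (step c b x)
    then have "b \<in> A" "c *\<^sub>C b \<in> A" using A B(1) by (auto simp: complex_vector.subspace_scale)
    with step A h(2) show ?case
      by (auto simp: h.add h.scale add scale complex_vector.subspace_add)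
  qed
  then show ?thesis using h(1) B(3) by blast
qed

lemma tensor_map_pure:
  assumes A: "complex_vector.subspace A"
    and f: "\<And>x y. x \<in> A \<Longrightarrow> y \<in> A \<Longrightarrow> f (x + y) = f x + f y"
      "\<And>c x. x \<in> A \<Longrightarrow> f (c *\<^sub>C x) = c *\<^sub>C f x"
    and B: "complex_vector.subspace B"
    and g: "\<And>x y. x \<in> B \<Longrightarrow> y \<in> B \<Longrightarrow> g (x + y) = g x + g y"
      "\<And>c x. x \<in> B \<Longrightarrow> g (c *\<^sub>C x) = c *\<^sub>C g x"
  shows clinear_tensor_map: "clinear (tensor_map A B f g)"
    and tensor_map_pure_tensor: "\<lbrakk>a \<in> A; b \<in> B\<rbrakk> \<Longrightarrow> tensor_map A B f g (a \<otimes>\<^sub>t b) = f a \<otimes>\<^sub>t g b"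
proof -
  obtain f' where f': "clinear f'" "\<forall>x\<in>A. f' x = f x"
    using linear_on_extend[OF A f] by metis
  obtain g' where g': "clinear g'" "\<forall>x\<in>B. g' x = g x"
    using linear_on_extend[OF B g] by metis
  interpret f': Vector_Spaces.linear scaleC scaleC f' by (fact f'(1))
  interpret g': Vector_Spaces.linear scaleC scaleC g' by (fact g'(1))
  define L where "L = free_lift (\<lambda>(a, b). f' a \<otimes>\<^sub>t g' b)"
  interpret L: Vector_Spaces.linear scaleC scaleC L unfolding L_def by (rule clinear_free_lift)
  have L_single: "L (Poly_Mapping.single (a, b) c) = c *\<^sub>C (f' a \<otimes>\<^sub>t g' b)" for a b c
    by (simp add: L_def free_lift_single)
  have "L x = 0" if "x \<in> tensor_relations" for x
    using that unfolding tensor_relations_def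
    by (auto simp: L.diff L.scale L_single scaleC_one f'.add g'.add f'.scale g'.scale
        pure_tensor_add_left pure_tensor_add_right pure_tensor_scale_left pure_tensor_scale_right)
  then have L0: "L x = 0" if "x \<in> complex_vector.span tensor_relations" for x
    using that by (rule L.eq_0_on_span)
  have L_cong: "L x = L y" if "tensor_rel x y" for x y
    using L0[of "x - y"] that by (simp add: tensor_rel_def L.diff)
  define h where "h = (\<lambda>x. L (rep_tensor x))"
  have h_abs: "h (abs_tensor x) = L x" for x
    unfolding h_def
    by (intro L_cong Quotient_rep_abs[OF Quotient_tensor] equivp_reflp[OF equivp_tensor_rel])
  have "clinear h"
  proof unfold_locales
    fix x y :: "('a, 'b) tensor" and c :: complex
    obtain u v where u: "x = abs_tensor u" and v: "y = abs_tensor v"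
      using Quotient_abs_rep[OF Quotient_tensor] by metis
    show "h (x + y) = h x + h y"
      unfolding u v by (simp add: plus_tensor.abs_eq h_abs L.add)
    show "h (c *\<^sub>C x) = c *\<^sub>C h x"
      unfolding u by (simp add: scaleC_tensor.abs_eq h_abs L.scale)
  qed
  moreover have "h (a \<otimes>\<^sub>t b) = f a \<otimes>\<^sub>t g b" if "a \<in> A" "b \<in> B" for a b
    using that f'(2) g'(2) by (simp add: pure_tensor.abs_eq h_abs L_single scaleC_one)
  ultimately have "\<exists>h. clinear h \<and> (\<forall>a\<in>A. \<forall>b\<in>B. h (a \<otimes>\<^sub>t b) = f a \<otimes>\<^sub>t g b)" by blast
  from someI_ex[OF this] show "clinear (tensor_map A B f g)"
    and "\<lbrakk>a \<in> A; b \<in> B\<rbrakk> \<Longrightarrow> tensor_map A B f g (a \<otimes>\<^sub>t b) = f a \<otimes>\<^sub>t g b"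
    unfolding tensor_map_def by auto
qed


section \<open>Graded modules and graded traces\<close>

text \<open>A graded space is given by its graded pieces inside an ambient vector space.\<close>

definition graded_total :: "(nat \<Rightarrow> 'a::complex_vector set) \<Rightarrow> 'a set" where
  "graded_total M = complex_vector.span (\<Union>d. M d)"

locale graded_module = group G
  for G :: "('g, 'k) monoid_scheme" (structure)
    and M :: "nat \<Rightarrow> 'a::complex_vector set"
    and act :: "'g \<Rightarrow> 'a \<Rightarrow> 'a" +
  assumes subspace_pieces: "complex_vector.subspace (M d)"
    and direct_sum: "\<lbrakk>finite D; \<And>d. d \<in> D \<Longrightarrow> v d \<in> M d; (\<Sum>d\<in>D. v d) = 0\<rbrakk> \<Longrightarrow> \<forall>d\<in>D. v d = 0"
    and finite_dimensional: "\<exists>B. finite B \<and> graded_total M = complex_vector.span B"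
    and act_add: "\<lbrakk>g \<in> carrier G; x \<in> graded_total M; y \<in> graded_total M\<rbrakk>
                    \<Longrightarrow> act g (x + y) = act g x + act g y"
    and act_scale: "\<lbrakk>g \<in> carrier G; x \<in> graded_total M\<rbrakk> \<Longrightarrow> act g (c *\<^sub>C x) = c *\<^sub>C act g x"
    and act_graded: "\<lbrakk>g \<in> carrier G; x \<in> M d\<rbrakk> \<Longrightarrow> act g x \<in> M d"
    and act_one: "x \<in> graded_total M \<Longrightarrow> act \<one> x = x"
    and act_mult: "\<lbrakk>g \<in> carrier G; h \<in> carrier G; x \<in> graded_total M\<rbrakk>
                    \<Longrightarrow> act (g \<otimes> h) x = act g (act h x)"

text \<open>The grading parameter is an argument of graded traces and Frobenius images, so that
  \<open>graded_trace M f (tvar ^ r)\<close> is the graded trace with \<open>t\<close> replaced by its \<open>r\<close>-th power.\<close>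

abbreviation tvar :: "complex poly" where
  "tvar \<equiv> [:0, 1:]"

definition graded_trace ::
  "(nat \<Rightarrow> 'a::complex_vector set) \<Rightarrow> ('a \<Rightarrow> 'a) \<Rightarrow> complex poly \<Rightarrow> complex poly" where
  "graded_trace M f q = (\<Sum>d | M d \<noteq> {0}. q ^ d * [:trace_on (M d) f:])"


section \<open>Polynomials in several variables\<close>

type_synonym ('x, 'k) mpoly = "('x \<Rightarrow>\<^sub>0 nat) \<Rightarrow>\<^sub>0 'k"

definition mconst :: "'k::comm_ring_1 \<Rightarrow> ('x, 'k) mpoly" where
  "mconst c = Poly_Mapping.single 0 c"

definition mvar :: "'x \<Rightarrow> ('x, 'k::comm_ring_1) mpoly" where
  "mvar x = Poly_Mapping.single (Poly_Mapping.single x 1) 1"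

text \<open>The algebra homomorphism sending each variable \<open>x\<close> to \<open>s x\<close>.\<close>

definition msubst :: "('x \<Rightarrow> ('y, 'k) mpoly) \<Rightarrow> ('x, 'k::comm_ring_1) mpoly \<Rightarrow> ('y, 'k) mpoly" where
  "msubst s f = (\<Sum>m\<in>Poly_Mapping.keys f. mconst (Poly_Mapping.lookup f m) * (\<Prod>x\<in>Poly_Mapping.keys m. s x ^ Poly_Mapping.lookup m x))"

lemma mconst_hom [simp]:
  "mconst 0 = 0" "mconst 1 = 1" "mconst (a + b) = mconst a + mconst b" "mconst (a * b) = mconst a * mconst b"
  by (simp_all add: mconst_def single_add mult_single)

definition mmonom :: "('x \<Rightarrow> ('y, 'k::comm_ring_1) mpoly) \<Rightarrow> ('x \<Rightarrow>\<^sub>0 nat) \<Rightarrow> ('y, 'k) mpoly" where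
  "mmonom s m = (\<Prod>x\<in>Poly_Mapping.keys m. s x ^ Poly_Mapping.lookup m x)"

lemma mmonom_superset:
  "finite X \<Longrightarrow> Poly_Mapping.keys m \<subseteq> X \<Longrightarrow> mmonom s m = (\<Prod>x\<in>X. s x ^ Poly_Mapping.lookup m x)"
  unfolding mmonom_def by (rule prod.mono_neutral_left) (auto simp: in_keys_iff)

lemma mmonom_add: "mmonom s (m + m') = mmonom s m * mmonom s m'"
proof -
  let ?X = "Poly_Mapping.keys m \<union> Poly_Mapping.keys m'"
  show ?thesis
    using Poly_Mapping.keys_add[of m m']
    by (simp add: mmonom_superset[of ?X] lookup_add power_add prod.distrib)
qed

lemma msubst_superset:
  "finite X \<Longrightarrow> Poly_Mapping.keys f \<subseteq> X \<Longrightarrow>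
    msubst s f = (\<Sum>m\<in>X. mconst (Poly_Mapping.lookup f m) * mmonom s m)"
  unfolding msubst_def mmonom_def by (rule sum.mono_neutral_left) (auto simp: in_keys_iff)

lemma msubst_single: "msubst s (Poly_Mapping.single m c) = mconst c * mmonom s m"
  by (subst msubst_superset[of "{m}"]) auto

lemma msubst_mconst: "msubst s (mconst c) = mconst c"
  by (simp add: mconst_def msubst_single mmonom_def)

lemma msubst_mvar: "msubst s (mvar x) = s x"
  by (simp add: mvar_def msubst_single mmonom_def)

lemma msubst_add: "msubst s (f + g) = msubst s f + msubst s g"
proof -
  let ?X = "Poly_Mapping.keys f \<union> Poly_Mapping.keys g"
  show ?thesis
    using Poly_Mapping.keys_add[of f g]
    by (simp add: msubst_superset[of ?X] lookup_add algebra_simps sum.distrib)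
qed

lemma mpoly_induct [case_names single add]:
  assumes "\<And>m c. P (Poly_Mapping.single m c)" "\<And>f g. P f \<Longrightarrow> P g \<Longrightarrow> P (f + g)"
  shows "P (f :: ('x, 'k::comm_ring_1) mpoly)"
proof (induction f rule: update_induct)
  case const show ?case using assms(1)[of 0 0] by simp
next
  case (update f a b)
  have "Poly_Mapping.update a b f = f + Poly_Mapping.single a b"
    using update(1) by (intro poly_mapping_eqI) (auto simp: lookup_update lookup_add lookup_single in_keys_iff when_def)
  then show ?case using assms update by simp
qed

lemma msubst_mult: "msubst s (f * g) = msubst s f * msubst s g"
proof (induction f rule: mpoly_induct)
  case (single m c)
  show ?case
  proof (induction g rule: mpoly_induct)
    case (single m' c')
    show ?case by (simp add: mult_single msubst_single mmonom_add mult_ac)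
  qed (simp add: msubst_add distrib_left)
qed (simp add: msubst_add distrib_right)


section \<open>Frobenius images for symmetric groups\<close>

text \<open>The ring of symmetric functions over \<open>\<complex>[t]\<close> is the polynomial ring in the power sums
  \<open>p\<^sub>s\<close>, \<open>s \<ge> 1\<close>; here \<open>p\<^sub>s\<close> is the variable with index \<open>s\<close>.\<close>

type_synonym symfun = "(nat, complex poly) mpoly"

definition power_sum :: "nat multiset \<Rightarrow> symfun" where
  "power_sum \<mu> = (\<Prod>s\<in>#\<mu>. mvar s)"

text \<open>Cycles, fixed points included, are identified with their supports.\<close>

definition cycles :: "nat \<Rightarrow> (nat \<Rightarrow> nat) \<Rightarrow> nat set set" where
  "cycles n w = Orbits.orbit w ` {1..n}"

definition cycle_type :: "nat \<Rightarrow> (nat \<Rightarrow> nat) \<Rightarrow> nat multiset" where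
  "cycle_type n w = image_mset card (mset_set (cycles n w))"

definition Frob :: "nat \<Rightarrow> (nat \<Rightarrow> 'a::complex_vector set) \<Rightarrow> ((nat \<Rightarrow> nat) \<Rightarrow> 'a \<Rightarrow> 'a) \<Rightarrow>
    complex poly \<Rightarrow> symfun" where
  "Frob n M act q = mconst [:1 / fact n:] *
     (\<Sum>w\<in>carrier (sym_group n). mconst (graded_trace M (act w) q) * power_sum (cycle_type n w))"


section \<open>The groups \<open>\<Gamma>\<close> and \<open>\<Gamma>\<^sub>n\<close>\<close>

definition Gamma :: "nat \<Rightarrow> complex monoid" where
  "Gamma r = \<lparr>carrier = {z. z ^ r = 1}, mult = (*), one = 1\<rparr>"

text \<open>The semidirect product, with \<^term>\<open>w\<close> acting on \<open>\<Gamma>\<^sup>n\<close> by permuting the positions. This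
  is the multiplication for which \<open>x\<^sub>k \<mapsto> g\<^bsub>w(k)\<^esub> x\<^bsub>w(k)\<^esub>\<close> is a left action.\<close>

definition Gamma_wreath :: "nat \<Rightarrow> nat \<Rightarrow> ((nat \<Rightarrow> complex) \<times> (nat \<Rightarrow> nat)) monoid" where
  "Gamma_wreath r n =
    \<lparr>carrier = ({1..n} \<rightarrow>\<^sub>E carrier (Gamma r)) \<times> carrier (sym_group n),
     mult = (\<lambda>(g, w) (h, v). (\<lambda>k\<in>{1..n}. g k * h (inv' w k), w \<circ> v)),
     one = (\<lambda>k\<in>{1..n}. 1, id)\<rparr>"

lemma group_Gamma: "r \<ge> 1 \<Longrightarrow> group (Gamma r)"
proof (rule groupI)
  fix x assume r: "r \<ge> 1" and "x \<in> carrier (Gamma r)"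
  then have "x ^ r = 1" by (simp add: Gamma_def)
  moreover from this r have "x \<noteq> 0" by (auto simp: power_0_left)
  ultimately show "\<exists>y\<in>carrier (Gamma r). y \<otimes>\<^bsub>Gamma r\<^esub> x = \<one>\<^bsub>Gamma r\<^esub>"
    by (intro bexI[of _ "inverse x"]) (auto simp: Gamma_def power_inverse)
qed (auto simp: Gamma_def power_mult_distrib)

lemma generator_power_eq_1_iff:
  assumes r: "r \<ge> 1" and \<zeta>: "\<zeta> \<in> carrier (Gamma r)" "generate (Gamma r) {\<zeta>} = carrier (Gamma r)"
  shows "\<zeta> ^ k = 1 \<longleftrightarrow> r dvd k"
proof -
  interpret group "Gamma r" using r by (rule group_Gamma)
  have "card (carrier (Gamma r)) = r"
    using r card_roots_unity_eq[of r] by (simp add: Gamma_def)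
  then have "ord \<zeta> = r"
    using generate_pow_card[OF \<zeta>(1)] \<zeta>(2) by simp
  moreover have "\<zeta> [^]\<^bsub>Gamma r\<^esub> k = \<zeta> ^ k"
    by (induction k) (simp_all add: nat_pow_def, simp_all add: Gamma_def)
  moreover have "\<one>\<^bsub>Gamma r\<^esub> = 1" by (simp add: Gamma_def)
  ultimately show ?thesis using pow_eq_id[OF \<zeta>(1), of k] by simp
qed

lemma generator_orthogonality:
  assumes r: "r \<ge> 1" and \<zeta>: "\<zeta> \<in> carrier (Gamma r)" "generate (Gamma r) {\<zeta>} = carrier (Gamma r)"
    and jk: "j < r" "k < r"
  shows "(\<Sum>i<r. \<zeta> ^ (i * j) * inverse \<zeta> ^ (i * k)) = (if j = k then of_nat r else 0)"
proof -
  have r1: "\<zeta> ^ r = 1" using \<zeta>(1) by (simp add: Gamma_def)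
  then have nz: "\<zeta> \<noteq> 0" using r by (metis One_nat_def le_zero_eq power_0_left zero_neq_one nat.distinct(1))
  define z where "z = \<zeta> ^ j * inverse \<zeta> ^ k"
  have "(\<Sum>i<r. \<zeta> ^ (i * j) * inverse \<zeta> ^ (i * k)) = (\<Sum>i<r. z ^ i)"
    by (simp add: z_def power_mult_distrib power_mult [symmetric] mult.commute)
  moreover have "z ^ r = 1"
    by (simp add: z_def power_mult_distrib power_mult [symmetric] mult.commute[of _ r] power_inverse)
       (simp add: power_mult r1)
  moreover have "z = 1 \<longleftrightarrow> j = k"
  proof
    assume "z = 1"
    then have eq: "\<zeta> ^ j = \<zeta> ^ k" using nz by (simp add: z_def field_simps power_inverse)
    have *: "a = b" if "a \<le> b" "b < r" "\<zeta> ^ a = \<zeta> ^ b" for a b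
    proof -
      have "\<zeta> ^ a * \<zeta> ^ (b - a) = \<zeta> ^ a * 1"
        unfolding power_add [symmetric] le_add_diff_inverse[OF that(1)] mult_1_right by (simp add: that(3))
      then have "\<zeta> ^ (b - a) = 1" using nz by simp
      then have "r dvd b - a" using generator_power_eq_1_iff[OF r \<zeta>] by simp
      then show ?thesis using that by (metis diff_le_self dual_order.strict_trans2 nat_dvd_not_less not_gr0 diff_is_0_eq le_antisym)
    qed
    show "j = k" using *[of j k] *[of k j] eq jk by (metis nat_le_linear)
  qed (use nz in \<open>simp add: z_def power_inverse\<close>)
  ultimately show ?thesis
    by (auto simp: sum_gp_strict)
qed

lemma group_Gamma_wreath:
  assumes "r \<ge> 1" shows "group (Gamma_wreath r n)"
proof (rule groupI)
  have mem: "w k \<in> {1..n} \<longleftrightarrow> k \<in> {1..n}" "inv' w k \<in> {1..n} \<longleftrightarrow> k \<in> {1..n}"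
      "inv' w (w k) = k" "w (inv' w k) = k" if "w permutes {1..n}" for w k
    using permutes_in_image[OF that] permutes_in_image[OF permutes_inv[OF that]]
      permutes_inverses[OF that] by auto
  {
    fix x y assume "x \<in> carrier (Gamma_wreath r n)" "y \<in> carrier (Gamma_wreath r n)"
    then show "x \<otimes>\<^bsub>Gamma_wreath r n\<^esub> y \<in> carrier (Gamma_wreath r n)"
      by (cases x; cases y)
        (auto simp: Gamma_wreath_def sym_group_def Gamma_def PiE_def Pi_def power_mult_distrib
          permutes_compose mem simp del: atLeastAtMost_iff One_nat_def)
  next
    show "\<one>\<^bsub>Gamma_wreath r n\<^esub> \<in> carrier (Gamma_wreath r n)"
      by (auto simp: Gamma_wreath_def sym_group_def Gamma_def permutes_id)
  next
    fix x y z assume "x \<in> carrier (Gamma_wreath r n)" "y \<in> carrier (Gamma_wreath r n)"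
      "z \<in> carrier (Gamma_wreath r n)"
    then show "x \<otimes>\<^bsub>Gamma_wreath r n\<^esub> y \<otimes>\<^bsub>Gamma_wreath r n\<^esub> z =
        x \<otimes>\<^bsub>Gamma_wreath r n\<^esub> (y \<otimes>\<^bsub>Gamma_wreath r n\<^esub> z)"
      by (cases x; cases y; cases z)
        (auto simp: Gamma_wreath_def sym_group_def mem mult.assoc o_inv_distrib permutes_bij
          restrict_def fun_eq_iff simp del: atLeastAtMost_iff One_nat_def)
  next
    fix x assume "x \<in> carrier (Gamma_wreath r n)"
    then show "\<one>\<^bsub>Gamma_wreath r n\<^esub> \<otimes>\<^bsub>Gamma_wreath r n\<^esub> x = x"
      by (cases x) (auto simp: Gamma_wreath_def PiE_def intro!: extensionalityI)
  next
    fix x assume "x \<in> carrier (Gamma_wreath r n)"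
    then obtain g w where x: "x = (g, w)" "g \<in> {1..n} \<rightarrow>\<^sub>E {z. z ^ r = 1}" "w permutes {1..n}"
      by (cases x) (auto simp: Gamma_wreath_def sym_group_def Gamma_def)
    let ?y = "(\<lambda>k\<in>{1..n}. inverse (g (w k)), inv' w)"
    have gr: "g k ^ r = 1" if "k \<in> {1..n}" for k using x(2) that by (auto simp: PiE_def Pi_def)
    have nz: "g k \<noteq> 0" if "k \<in> {1..n}" for k using gr[OF that] assms by (auto simp: power_0_left)
    have "?y \<in> carrier (Gamma_wreath r n)"
      using x(3) by (auto simp: Gamma_wreath_def sym_group_def Gamma_def permutes_inv power_inverse gr mem
          simp del: atLeastAtMost_iff One_nat_def)
    moreover have "?y \<otimes>\<^bsub>Gamma_wreath r n\<^esub> x = \<one>\<^bsub>Gamma_wreath r n\<^esub>"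
      using x(3) nz by (auto simp: x(1) Gamma_wreath_def inv_inv_eq permutes_bij permutes_inv_o mem
          restrict_def fun_eq_iff simp del: atLeastAtMost_iff One_nat_def)
    ultimately show "\<exists>y\<in>carrier (Gamma_wreath r n). y \<otimes>\<^bsub>Gamma_wreath r n\<^esub> x = \<one>\<^bsub>Gamma_wreath r n\<^esub>" ..
  }
qed


section \<open>Frobenius images for \<open>\<Gamma>\<^sub>n\<close>\<close>

text \<open>In the ring \<open>\<Lambda>\<^sup>\<Gamma>\<close>, the variable with index \<open>(i, s)\<close> is \<open>p\<^sub>s[X\<^sup>(\<^sup>i\<^sup>)]\<close>,
  for \<open>i < r\<close> and \<open>s \<ge> 1\<close>.\<close>

type_synonym wreath_symfun = "(nat \<times> nat, complex poly) mpoly"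

text \<open>The generators \<open>p\<close>-hat attached to conjugacy classes, as the solution of the linear system
  expressing the \<open>p\<^sub>s[X\<^sup>(\<^sup>j\<^sup>)]\<close> through them. For fixed \<open>s\<close> the
  solution is unique, see \<open>ex1_hat_power_sum\<close> below.\<close>

definition is_hat_power_sum :: "nat \<Rightarrow> complex \<Rightarrow> nat \<Rightarrow> (nat \<Rightarrow> wreath_symfun) \<Rightarrow> bool" where
  "is_hat_power_sum r \<zeta> s q \<longleftrightarrow>
     (\<forall>j<r. mvar (j, s) = mconst [:1 / of_nat r:] * (\<Sum>i<r. mconst [:\<zeta> ^ (i * j):] * q i))"

lemma ex1_hat_power_sum:
  assumes r: "r \<ge> 1" and \<zeta>: "\<zeta> \<in> carrier (Gamma r)" "generate (Gamma r) {\<zeta>} = carrier (Gamma r)"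
  shows "\<exists>!q. q \<in> extensional {..<r} \<and> is_hat_power_sum r \<zeta> s q"
proof -
  define c :: "complex \<Rightarrow> wreath_symfun" where "c = (\<lambda>x. mconst [:x:])"
  have c_mult: "c a * c b = c (a * b)" for a b
    unfolding c_def mconst_hom(4) [symmetric] by (simp add: mult.commute)
  have c_sum: "(\<Sum>i\<in>I. c (f i)) = c (\<Sum>i\<in>I. f i)" for f and I :: "nat set"
    by (induction I rule: infinite_finite_induct) (simp_all add: c_def flip: mconst_hom(3))
  have c0: "c 0 = 0" and c1: "c 1 = 1" by (simp_all add: c_def flip: one_pCons)
  define q0 where "q0 = (\<lambda>i\<in>{..<r}. \<Sum>k<r. c (inverse \<zeta> ^ (i * k)) * mvar (k, s))"
  note orth = generator_orthogonality[OF r \<zeta>]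
  show ?thesis
  proof (rule ex1I[of _ q0])
    have "mvar (j, s) = c (1 / of_nat r) * (\<Sum>i<r. c (\<zeta> ^ (i * j)) * q0 i)" if j: "j < r" for j
    proof -
      have "(\<Sum>i<r. c (\<zeta> ^ (i * j)) * q0 i)
          = (\<Sum>i<r. \<Sum>k<r. c (\<zeta> ^ (i * j) * inverse \<zeta> ^ (i * k)) * mvar (k, s))"
        by (simp add: q0_def sum_distrib_left mult.assoc flip: c_mult)
      also have "\<dots> = (\<Sum>k<r. c (\<Sum>i<r. \<zeta> ^ (i * j) * inverse \<zeta> ^ (i * k)) * mvar (k, s))"
        by (subst sum.swap) (simp add: sum_distrib_right flip: c_sum)
      also have "\<dots> = (\<Sum>k<r. if k = j then c (of_nat r) * mvar (k, s) else 0)"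
        using j by (intro sum.cong) (auto simp: orth c0)
      also have "\<dots> = c (of_nat r) * mvar (j, s)" using j by simp
      finally show ?thesis using r by (simp add: c_mult c1 flip: mult.assoc)
    qed
    then have "is_hat_power_sum r \<zeta> s q0"
      unfolding is_hat_power_sum_def c_def by blast
    then show "q0 \<in> extensional {..<r} \<and> is_hat_power_sum r \<zeta> s q0"
      by (simp add: q0_def)
  next
    fix q assume q: "q \<in> extensional {..<r} \<and> is_hat_power_sum r \<zeta> s q"
    have "q i = q0 i" if i: "i < r" for i
    proof -
      have "q0 i = (\<Sum>k<r. c (inverse \<zeta> ^ (i * k)) * (c (1 / of_nat r) * (\<Sum>l<r. c (\<zeta> ^ (l * k)) * q l)))"
        using q i by (simp add: q0_def is_hat_power_sum_def c_def)
      also have "\<dots> = (\<Sum>k<r. \<Sum>l<r. c (1 / of_nat r) * (c (\<zeta> ^ (k * l) * inverse \<zeta> ^ (k * i)) * q l))"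
        by (simp add: sum_distrib_left mult_ac flip: c_mult)
      also have "\<dots> = (\<Sum>l<r. c (1 / of_nat r) * (c (\<Sum>k<r. \<zeta> ^ (k * l) * inverse \<zeta> ^ (k * i)) * q l))"
        by (subst sum.swap) (simp add: sum_distrib_right sum_distrib_left flip: c_sum)
      also have "\<dots> = (\<Sum>l<r. if l = i then c (1 / of_nat r) * (c (of_nat r) * q l) else 0)"
        using i by (intro sum.cong) (auto simp: orth c0)
      also have "\<dots> = q i" using i r by (simp add: c_mult c1 flip: mult.assoc)
      finally show ?thesis ..
    qed
    then show "q = q0" using q by (intro extensionalityI[of _ "{..<r}"]) (auto simp: q0_def)
  qed
qed

definition hat_power_sum :: "nat \<Rightarrow> complex \<Rightarrow> nat \<Rightarrow> nat \<Rightarrow> wreath_symfun" where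
  "hat_power_sum r \<zeta> i s = (THE q. q \<in> extensional {..<r} \<and> is_hat_power_sum r \<zeta> s q) i"

definition colored_cycle_type ::
  "nat \<Rightarrow> complex \<Rightarrow> (nat \<Rightarrow> complex) \<times> (nat \<Rightarrow> nat) \<Rightarrow> nat \<Rightarrow> nat multiset" where
  "colored_cycle_type n \<zeta> = (\<lambda>(g, w) i.
     image_mset card (mset_set {C \<in> cycles n w. (\<Prod>a\<in>C. g a) = \<zeta> ^ i}))"

definition hat_power_sum_tuple :: "nat \<Rightarrow> complex \<Rightarrow> (nat \<Rightarrow> nat multiset) \<Rightarrow> wreath_symfun" where
  "hat_power_sum_tuple r \<zeta> \<mu> = (\<Prod>i<r. \<Prod>s\<in>#\<mu> i. hat_power_sum r \<zeta> i s)"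

definition Frob_Gamma ::
  "nat \<Rightarrow> nat \<Rightarrow> complex \<Rightarrow> (nat \<Rightarrow> 'a::complex_vector set) \<Rightarrow>
    ((nat \<Rightarrow> complex) \<times> (nat \<Rightarrow> nat) \<Rightarrow> 'a \<Rightarrow> 'a) \<Rightarrow> complex poly \<Rightarrow> wreath_symfun" where
  "Frob_Gamma r n \<zeta> M act q = mconst [:1 / of_nat (order (Gamma_wreath r n)):] *
     (\<Sum>g\<in>carrier (Gamma_wreath r n).
        mconst (graded_trace M (act g) q) * hat_power_sum_tuple r \<zeta> (colored_cycle_type n \<zeta> g))"


section \<open>Graded induction\<close>

definition poly_action ::
  "(nat \<Rightarrow> complex) \<times> (nat \<Rightarrow> nat) \<Rightarrow> (nat, complex) mpoly \<Rightarrow> (nat, complex) mpoly" where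
  "poly_action = (\<lambda>(g, w). msubst (\<lambda>k. mconst (g (w k)) * mvar (w k)))"

lemma poly_action_mult:
  assumes "g \<in> carrier (Gamma_wreath r n)" "h \<in> carrier (Gamma_wreath r n)" "k \<in> {1..n}"
  shows "poly_action (g \<otimes>\<^bsub>Gamma_wreath r n\<^esub> h) (mvar k) = poly_action g (poly_action h (mvar k))"
  using assms permutes_in_image[of "snd g" "{1..n}"] permutes_in_image[of "snd h" "{1..n}"]
    permutes_inverses[of "snd g" "{1..n}"]
  by (cases g; cases h)
    (auto simp: poly_action_def Gamma_wreath_def sym_group_def msubst_mvar msubst_mult msubst_mconst mult_ac
      simp del: atLeastAtMost_iff One_nat_def)

text \<open>The graded pieces of \<open>S\<^sub><\<^sub>r\<close>, a submodule of the polynomial ring in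
  \<open>x\<^sub>1, \<dots>, x\<^sub>n\<close>.\<close>

definition truncated_poly :: "nat \<Rightarrow> nat \<Rightarrow> nat \<Rightarrow> (nat, complex) mpoly set" where
  "truncated_poly r n d = complex_vector.span
     {Poly_Mapping.single m 1 | m.
        Poly_Mapping.keys m \<subseteq> {1..n} \<and> (\<forall>k\<in>{1..n}. Poly_Mapping.lookup m k < r) \<and> (\<Sum>k=1..n. Poly_Mapping.lookup m k) = d}"

definition dilate :: "nat \<Rightarrow> (nat \<Rightarrow> 'a::complex_vector set) \<Rightarrow> nat \<Rightarrow> 'a set" where
  "dilate r M e = (if r dvd e then M (e div r) else {0})"

text \<open>Since \<open>\<complex>\<close> is a field, the tensor product of two subspaces embeds into that of the
  ambient spaces, as the span of the pure tensors with factors in the subspaces.\<close>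

definition tensor_grading ::
  "(nat \<Rightarrow> 'a::complex_vector set) \<Rightarrow> (nat \<Rightarrow> 'b::complex_vector set) \<Rightarrow> nat \<Rightarrow> ('a, 'b) tensor set" where
  "tensor_grading M N d =
     complex_vector.span {a \<otimes>\<^sub>t b | a b i j. i + j = d \<and> a \<in> M i \<and> b \<in> N j}"

definition Ind_grading ::
  "nat \<Rightarrow> nat \<Rightarrow> (nat \<Rightarrow> 'a::complex_vector set) \<Rightarrow> nat \<Rightarrow> ((nat, complex) mpoly, 'a) tensor set" where
  "Ind_grading r n M = tensor_grading (truncated_poly r n) (dilate r M)"

definition Ind_action ::
  "nat \<Rightarrow> nat \<Rightarrow> (nat \<Rightarrow> 'a::complex_vector set) \<Rightarrow> ((nat \<Rightarrow> nat) \<Rightarrow> 'a \<Rightarrow> 'a) \<Rightarrow>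
    (nat \<Rightarrow> complex) \<times> (nat \<Rightarrow> nat) \<Rightarrow>
    ((nat, complex) mpoly, 'a) tensor \<Rightarrow> ((nat, complex) mpoly, 'a) tensor" where
  "Ind_action r n M act g =
     tensor_map (graded_total (truncated_poly r n)) (graded_total (dilate r M))
       (poly_action g) (act (snd g))"


section \<open>Plethysm\<close>

text \<open>\<open>f[X\<^sup>(\<^sup>0\<^sup>) + t X\<^sup>(\<^sup>1\<^sup>) + \<dots> + t\<^sup>r\<^sup>-\<^sup>1 X\<^sup>(\<^sup>r\<^sup>-\<^sup>1\<^sup>)]\<close>\<close>

definition wreath_plethysm :: "nat \<Rightarrow> symfun \<Rightarrow> wreath_symfun" where
  "wreath_plethysm r = msubst (\<lambda>s. \<Sum>i<r. mconst (tvar ^ (i * s)) * mvar (i, s))"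

end

theory Submission
  imports Defs
begin

text \<open>
  Both sides are averages of a trace times a power sum. The factor \<open>1 / |\<Gamma>\<^sub>n|\<close> is
  \<open>1 / (r\<^sup>n n!)\<close>, so it suffices to fix \<open>w \<in> S\<^sub>n\<close> and to show that the sum of
  \<open>Tr(g; t)\<close> times the \<open>p\<close>-hat of the cycle type of \<open>g\<close>, over the \<open>r\<^sup>n\<close> elements
  \<open>g = (g\<^sub>1, \<dots>, g\<^sub>n, w)\<close> above \<open>w\<close>, is \<open>r\<^sup>n\<close> times the plethystic image of
  \<open>Tr\<^sub>M(w; t\<^sup>r) p\<^bsub>\<tau>(w)\<^esub>\<close> (lemma \<open>sum_colorings\<close>).

  Graded traces are multiplicative on tensor products (\<open>graded_trace_tensor\<close>), so the trace of
  \<open>g\<close> on the induced module is \<open>Tr\<^sub>M(w; t\<^sup>r)\<close> times the trace on \<open>S\<^sub><\<^sub>r\<close>. In the monomial basis,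
  \<open>g\<close> acts by a monomial matrix, and the monomials on its diagonal are those whose exponent is
  constant on every cycle \<open>C\<close> of \<open>w\<close>. An exponent \<open>c < r\<close> on \<open>C\<close> contributes the degree \<open>|C| c\<close> and the
  scalar \<open>g\<^sub>C\<^sup>c\<close>, hence the trace is \<open>\<Prod>\<^sub>C \<Sum>\<^bsub>c<r\<^esub> (t\<^bsup>|C|\<^esup> g\<^sub>C)\<^sup>c\<close>
  (\<open>graded_trace_poly_action\<close>).

  The factors for different cycles depend on disjoint sets of entries of \<open>g\<close>, so the
  sum over \<open>g\<close> is a product of sums over the cycles (\<open>sum_PiE_prod_blocks\<close>). On a cycle of length
  \<open>s\<close>, each color \<open>i\<close> is attained \<open>r\<^bsup>s - 1\<^esup>\<close> times (\<open>sum_PiE_Gamma_prod\<close>), and the sum over the colors is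
  \<open>\<Sum>\<^bsub>c<r\<^esub> t\<^bsup>sc\<^esup> \<Sum>\<^bsub>i<r\<^esub> \<zeta>\<^bsup>ic\<^esup>\<close> times the \<open>p\<close>-hat with indices \<open>i\<close> and \<open>s\<close>. By the definition of
  the \<open>p\<close>-hats the inner sum is \<open>r p\<^sub>s[X\<^sup>(\<^sup>c\<^sup>)]\<close> (\<open>sum_colors_cycle\<close>). So the cycle contributes \<open>r\<^sup>s\<close>
  times the image of \<open>p\<^sub>s\<close> under the plethysm, and the lengths \<open>s\<close> add up to \<open>n\<close>.
\<close>

section \<open>Traces through dual bases\<close>

text \<open>The family \<^term>\<open>v\<close> is a basis of \<^term>\<open>V\<close>, but this is recorded by functionals \<^term>\<open>\<phi> i\<close> on the
  ambient space instead of linear independence: such functionals can be written down directly for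
  monomials, and they multiply under tensor products, so that no independence argument for a
  tensor basis is needed.\<close>

definition dual_basis ::
  "'a::complex_vector set \<Rightarrow> 'i set \<Rightarrow> ('i \<Rightarrow> 'a) \<Rightarrow> ('i \<Rightarrow> 'a \<Rightarrow> complex) \<Rightarrow> bool" where
  "dual_basis V I v \<phi> \<longleftrightarrow> finite I \<and> V = complex_vector.span (v ` I) \<and>
     (\<forall>i\<in>I. clinear (\<phi> i)) \<and> (\<forall>i\<in>I. \<forall>j\<in>I. \<phi> i (v j) = (if i = j then 1 else 0))"

lemma dual_basis_expansion:
  assumes "dual_basis V I v \<phi>" and "x \<in> V"
  shows "x = (\<Sum>i\<in>I. \<phi> i x *\<^sub>C v i)"
proof -
  have I: "finite I" and V: "V = complex_vector.span (v ` I)"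
    and lin: "\<And>i. i \<in> I \<Longrightarrow> clinear (\<phi> i)"
    and dual: "\<And>i j. i \<in> I \<Longrightarrow> j \<in> I \<Longrightarrow> \<phi> i (v j) = (if i = j then 1 else 0)"
    using assms(1) by (auto simp: dual_basis_def)
  have "x \<in> complex_vector.span (v ` I)" using assms(2) V by simp
  then show ?thesis
  proof (induction rule: complex_vector.span_induct_alt)
    case base
    then show ?case
      by (simp add: complex_vector.linear_0[OF lin])
  next
    case (step c b x)
    then obtain j where j: "j \<in> I" "b = v j" by auto
    have "(\<Sum>i\<in>I. \<phi> i (c *\<^sub>C b + x) *\<^sub>C v i)
        = (\<Sum>i\<in>I. (if i = j then c *\<^sub>C v j else 0)) + (\<Sum>i\<in>I. \<phi> i x *\<^sub>C v i)"
      unfolding sum.distrib[symmetric]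
      by (intro sum.cong refl)
        (auto simp: j complex_vector.linear_add[OF lin] complex_vector.linear_scale[OF lin] dual scaleC_add_left)
    also have "\<dots> = c *\<^sub>C b + x" using I j step by simp
    finally show ?case by simp
  qed
qed

lemma ex_subspace_basis:
  assumes "complex_vector.subspace V"
  shows "\<exists>B. B \<subseteq> V \<and> complex_vector.independent B \<and> complex_vector.span B = V"
proof -
  obtain B where "B \<subseteq> V" "complex_vector.independent B" "V \<subseteq> complex_vector.span B"
    using complex_vector.maximal_independent_subset by metis
  moreover from this have "complex_vector.span B \<subseteq> V"
    using assms by (intro complex_vector.span_minimal)
  ultimately show ?thesis by blast
qed

text \<open>The actions of a graded module are linear only on the module, so
  sums are moved through them with the help of a globally linear extension.\<close>

lemma additive_homogeneous_sum:
  fixes f :: "'a::complex_vector \<Rightarrow> 'b::complex_vector"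
  assumes V: "complex_vector.subspace V"
    and add: "\<And>x y. x \<in> V \<Longrightarrow> y \<in> V \<Longrightarrow> f (x + y) = f x + f y"
    and scale: "\<And>c x. x \<in> V \<Longrightarrow> f (c *\<^sub>C x) = c *\<^sub>C f x"
    and v: "\<And>i. i \<in> I \<Longrightarrow> v i \<in> V"
  shows "f (\<Sum>i\<in>I. c i *\<^sub>C v i) = (\<Sum>i\<in>I. c i *\<^sub>C f (v i))"
proof -
  obtain h where h: "clinear h" "\<forall>x\<in>V. h x = f x"
    using linear_on_extend[OF V add scale] by metis
  have "(\<Sum>i\<in>I. c i *\<^sub>C v i) \<in> V"
    by (intro complex_vector.subspace_sum[OF V] complex_vector.subspace_scale[OF V] v)
  then have "f (\<Sum>i\<in>I. c i *\<^sub>C v i) = h (\<Sum>i\<in>I. c i *\<^sub>C v i)" using h(2) by simp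
  also have "\<dots> = (\<Sum>i\<in>I. c i *\<^sub>C h (v i))"
    by (simp add: complex_vector.linear_sum[OF h(1)] complex_vector.linear_scale[OF h(1)])
  finally show ?thesis using h(2) v by simp
qed

text \<open>Independence of the trace from the basis. Expanding each vector of the chosen basis \<open>B\<close> in the
  family \<open>v\<close> turns the diagonal sum over \<open>B\<close> into
  \<open>\<Sum>\<^sub>i \<phi>\<^sub>i (\<Sum>\<^sub>b f(v\<^sub>i)\<^sub>b b)\<close>, and the inner sum is the expansion of \<open>f(v\<^sub>i)\<close> in \<open>B\<close>.\<close>

lemma trace_on_dual_basis:
  assumes D: "dual_basis V I v \<phi>"
    and add: "\<And>x y. x \<in> V \<Longrightarrow> y \<in> V \<Longrightarrow> f (x + y) = f x + f y"
    and scale: "\<And>c x. x \<in> V \<Longrightarrow> f (c *\<^sub>C x) = c *\<^sub>C f x"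
    and closed: "\<And>x. x \<in> V \<Longrightarrow> f x \<in> V"
  shows "trace_on V f = (\<Sum>i\<in>I. \<phi> i (f (v i)))"
proof -
  have I: "finite I" and V: "V = complex_vector.span (v ` I)"
    and lin: "\<And>i. i \<in> I \<Longrightarrow> clinear (\<phi> i)"
    using D by (auto simp: dual_basis_def)
  have V_sub: "complex_vector.subspace V" unfolding V by (rule complex_vector.subspace_span)
  have vV: "v i \<in> V" if "i \<in> I" for i
    unfolding V using that by (intro complex_vector.span_base) auto
  define B where "B = (SOME B. B \<subseteq> V \<and> complex_vector.independent B \<and> complex_vector.span B = V)"
  have B: "B \<subseteq> V" "complex_vector.independent B" "complex_vector.span B = V"
    using someI_ex[OF ex_subspace_basis[OF V_sub]] unfolding B_def by blast+
  have "finite B"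
    using complex_vector.independent_span_bound[of "v ` I" B] I B V by auto
  let ?R = "complex_vector.representation B"
  have "trace_on V f = (\<Sum>b\<in>B. ?R (f b) b)"
    by (simp add: trace_on_def B_def Let_def)
  also have "\<dots> = (\<Sum>b\<in>B. \<Sum>i\<in>I. \<phi> i b * ?R (f (v i)) b)"
  proof (intro sum.cong refl)
    fix b assume b: "b \<in> B"
    have "f b = f (\<Sum>i\<in>I. \<phi> i b *\<^sub>C v i)"
      using dual_basis_expansion[OF D, of b] b B(1) by auto
    also have "\<dots> = (\<Sum>i\<in>I. \<phi> i b *\<^sub>C f (v i))"
      by (rule additive_homogeneous_sum[OF V_sub add scale vV])
    also have "?R \<dots> b = (\<Sum>i\<in>I. ?R (\<phi> i b *\<^sub>C f (v i)) b)"
      by (subst complex_vector.representation_sum)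
        (auto simp: B V_sub complex_vector.subspace_scale closed vV)
    also have "\<dots> = (\<Sum>i\<in>I. \<phi> i b * ?R (f (v i)) b)"
      by (intro sum.cong refl, subst complex_vector.representation_scale) (auto simp: B closed vV)
    finally show "?R (f b) b = (\<Sum>i\<in>I. \<phi> i b * ?R (f (v i)) b)" .
  qed
  also have "\<dots> = (\<Sum>i\<in>I. \<phi> i (\<Sum>b\<in>B. ?R (f (v i)) b *\<^sub>C b))"
    by (subst sum.swap, intro sum.cong refl)
      (simp add: complex_vector.linear_sum[OF lin] complex_vector.linear_scale[OF lin] mult.commute)
  also have "\<dots> = (\<Sum>i\<in>I. \<phi> i (f (v i)))"
    by (intro sum.cong refl arg_cong[where f = "\<phi> _"] complex_vector.sum_representation_eq)
      (auto simp: B closed vV \<open>finite B\<close>)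
  finally show ?thesis .
qed

section \<open>Homogeneous bases of graded spaces\<close>

definition graded_endo :: "(nat \<Rightarrow> 'a::complex_vector set) \<Rightarrow> ('a \<Rightarrow> 'a) \<Rightarrow> bool" where
  "graded_endo M f \<longleftrightarrow>
     (\<forall>x\<in>graded_total M. \<forall>y\<in>graded_total M. f (x + y) = f x + f y) \<and>
     (\<forall>c. \<forall>x\<in>graded_total M. f (c *\<^sub>C x) = c *\<^sub>C f x) \<and> (\<forall>d. \<forall>x\<in>M d. f x \<in> M d)"

text \<open>A dual basis of the whole graded space whose members of degree \<open>d\<close> span the piece
  of degree \<open>d\<close>. Finiteness of the index set includes that only finitely many pieces are nonzero.\<close>

definition homogeneous_basis ::
  "(nat \<Rightarrow> 'a::complex_vector set) \<Rightarrow> 'i set \<Rightarrow> ('i \<Rightarrow> nat) \<Rightarrow> ('i \<Rightarrow> 'a) \<Rightarrow>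
    ('i \<Rightarrow> 'a \<Rightarrow> complex) \<Rightarrow> bool" where
  "homogeneous_basis M I \<delta> v \<phi> \<longleftrightarrow> finite I \<and>
     (\<forall>d. M d = complex_vector.span (v ` {i \<in> I. \<delta> i = d})) \<and>
     (\<forall>i\<in>I. clinear (\<phi> i)) \<and> (\<forall>i\<in>I. \<forall>j\<in>I. \<phi> i (v j) = (if i = j then 1 else 0))"

lemma graded_total_superset: "M d \<subseteq> graded_total M"
  unfolding graded_total_def using complex_vector.span_superset by fastforce

text \<open>With a homogeneous basis, the graded trace becomes a single sum over basis vectors, each weighted by
  its degree; this is the form in which traces are multiplied and computed below.\<close>

lemma graded_trace_homogeneous_basis:
  assumes H: "homogeneous_basis M I \<delta> v \<phi>" and f: "graded_endo M f"
  shows "graded_trace M f q = (\<Sum>i\<in>I. q ^ \<delta> i * [:\<phi> i (f (v i)):])"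
proof -
  have I: "finite I" and D: "dual_basis (M d) {i \<in> I. \<delta> i = d} v \<phi>" for d
    using H by (auto simp: homogeneous_basis_def dual_basis_def)
  have tr: "trace_on (M d) f = (\<Sum>i | i \<in> I \<and> \<delta> i = d. \<phi> i (f (v i)))" for d
    using f graded_total_superset[of M d]
    by (intro trace_on_dual_basis[OF D]) (auto simp: graded_endo_def subset_iff)
  \<comment> \<open>Basis vectors are nonzero because a functional takes the value 1 on them, so the nonzero pieces
    are exactly those that contain a basis vector.\<close>
  have "{d. M d \<noteq> {0}} = \<delta> ` I"
  proof (intro equalityI subsetI)
    fix d assume d: "d \<in> {d. M d \<noteq> {0}}"
    show "d \<in> \<delta> ` I"
    proof (rule ccontr)
      assume "d \<notin> \<delta> ` I"
      then have "{i \<in> I. \<delta> i = d} = {}" by auto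
      moreover have "M d = complex_vector.span (v ` {i \<in> I. \<delta> i = d})"
        using H by (simp add: homogeneous_basis_def)
      ultimately have "M d = {0}" by (simp only: image_empty complex_vector.span_empty)
      then show False using d by simp
    qed
  next
    fix d assume "d \<in> \<delta> ` I"
    then obtain i where i: "i \<in> I" "d = \<delta> i" by blast
    have "v i \<in> M d"
      using H i by (auto simp: homogeneous_basis_def intro!: complex_vector.span_base)
    moreover have "\<phi> i 0 = 0" "\<phi> i (v i) = 1"
      using H i(1) by (simp_all add: homogeneous_basis_def complex_vector.linear_0)
    ultimately show "d \<in> {d. M d \<noteq> {0}}" by auto
  qed
  then have "graded_trace M f q = (\<Sum>d\<in>\<delta> ` I. q ^ d * [:trace_on (M d) f:])"
    by (simp only: graded_trace_def)
  also have "\<dots> = (\<Sum>d\<in>\<delta> ` I. \<Sum>i | i \<in> I \<and> \<delta> i = d. q ^ \<delta> i * [:\<phi> i (f (v i)):])"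
  proof (intro sum.cong refl)
    fix d
    have "[:\<Sum>i\<in>A. h i:] = (\<Sum>i\<in>A. [:h i:])" for h :: "'b \<Rightarrow> complex" and A
      by (intro poly_eqI) (simp add: coeff_sum coeff_pCons split: nat.split)
    then show "q ^ d * [:trace_on (M d) f:] = (\<Sum>i | i \<in> I \<and> \<delta> i = d. q ^ \<delta> i * [:\<phi> i (f (v i)):])"
      unfolding tr by (simp add: sum_distrib_left)
  qed
  also have "\<dots> = (\<Sum>i\<in>I. q ^ \<delta> i * [:\<phi> i (f (v i)):])"
    by (rule sum.image_gen[OF I, of "\<lambda>i. q ^ \<delta> i * [:\<phi> i (f (v i)):]" \<delta>, symmetric])
  finally show ?thesis .
qed

text \<open>The union of bases of the pieces is independent because the sum of the pieces is direct, and
  finite because the total space is finite-dimensional.\<close>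

lemma ex_homogeneous_basis:
  fixes M :: "nat \<Rightarrow> 'a::complex_vector set"
  assumes "graded_module G M act"
  shows "\<exists>(I :: 'a set) \<delta> v \<phi>. homogeneous_basis M I \<delta> v \<phi>"
proof -
  interpret graded_module G M act by fact
  have "\<forall>d. \<exists>B. B \<subseteq> M d \<and> complex_vector.independent B \<and> complex_vector.span B = M d"
    using ex_subspace_basis[OF subspace_pieces] by blast
  then obtain B where B: "\<And>d. B d \<subseteq> M d" "\<And>d. complex_vector.independent (B d)"
      "\<And>d. complex_vector.span (B d) = M d"
    unfolding choice_iff by blast
  \<comment> \<open>A common vector \<open>x\<close> of two pieces would give the relation \<open>x + (- x) = 0\<close>.\<close>
  have disj: "d = e" if "x \<in> B d" "x \<in> B e" for d e x
  proof (rule ccontr)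
    assume "d \<noteq> e"
    define u where "u = (\<lambda>k. if k = d then x else - x)"
    have u: "u d = x" "u e = - x" using \<open>d \<noteq> e\<close> by (auto simp: u_def)
    have "x \<in> M d" "- x \<in> M e"
      using that B(1) complex_vector.subspace_neg[OF subspace_pieces] by blast+
    then have "\<forall>k\<in>{d, e}. u k = 0"
      using \<open>d \<noteq> e\<close> by (intro direct_sum[of "{d, e}" u]) (auto simp: u)
    then have "x = 0" using u(1) by simp
    then show False using that(1) B(2) complex_vector.dependent_zero by blast
  qed
  define I where "I = (\<Union>d. B d)"
  define \<delta> where "\<delta> = (\<lambda>x. THE d. x \<in> B d)"
  have \<delta>: "\<delta> x = d" if "x \<in> B d" for x d
    unfolding \<delta>_def using that disj by blast
  have ind: "complex_vector.independent I"
    unfolding complex_vector.independent_explicit_module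
  proof (intro allI impI)
    fix t u x assume t: "finite t" "t \<subseteq> I" and zero: "(\<Sum>y\<in>t. u y *\<^sub>C y) = 0" and x: "x \<in> t"
    have tB: "{y \<in> t. \<delta> y = d} \<subseteq> B d" for d
      using t(2) \<delta> by (auto simp: I_def)
    let ?v = "\<lambda>d. \<Sum>y | y \<in> t \<and> \<delta> y = d. u y *\<^sub>C y"
    have "?v d \<in> M d" for d
      using tB[of d] B(1)[of d] subspace_pieces[of d]
      by (intro complex_vector.subspace_sum complex_vector.subspace_scale) auto
    moreover have "(\<Sum>d\<in>\<delta> ` t. ?v d) = 0"
      using sum.image_gen[OF t(1), of "\<lambda>y. u y *\<^sub>C y" \<delta>] zero by simp
    ultimately have "\<forall>d\<in>\<delta> ` t. ?v d = 0"
      using t(1) by (intro direct_sum) blast+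
    then have "?v (\<delta> x) = 0" using x by blast
    then show "u x = 0"
      by (intro complex_vector.independentD[OF B(2) _ tB]) (use t(1) x in auto)
  qed
  obtain S where S: "finite S" "graded_total M = complex_vector.span S"
    using finite_dimensional by blast
  have "I \<subseteq> complex_vector.span S"
    using B(1) graded_total_superset unfolding S(2)[symmetric] I_def by blast
  then have fin: "finite I"
    using complex_vector.independent_span_bound[OF S(1) ind] by blast
  define \<phi> :: "'a \<Rightarrow> 'a \<Rightarrow> complex" where "\<phi> = (\<lambda>b. complex_vector.construct I (\<lambda>x. if b = x then 1 else 0))"
  have "homogeneous_basis M I \<delta> id \<phi>"
    unfolding homogeneous_basis_def
  proof (intro conjI allI ballI)
    fix d
    have "{i \<in> I. \<delta> i = d} = B d" using \<delta> by (auto simp: I_def)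
    then show "M d = complex_vector.span (id ` {i \<in> I. \<delta> i = d})" using B(3) by simp
  next
    fix i show "clinear (\<phi> i)" unfolding \<phi>_def
      by (rule complex_vector.linear_construct[OF ind])
  next
    fix i j assume "i \<in> I" "j \<in> I"
    then show "\<phi> i (id j) = (if i = j then 1 else 0)"
      by (simp add: \<phi>_def complex_vector.construct_basis[OF ind])
  qed (rule fin)
  then show ?thesis by (intro exI)
qed

section \<open>Graded traces of dilations and tensor products\<close>

lemma graded_trace_dilate:
  assumes r: "r \<ge> 1"
  shows "graded_trace (dilate r M) f q = graded_trace M f (q ^ r)"
proof -
  have dil: "dilate r M (r * d) = M d" for d
    using r by (simp add: dilate_def)
  have "{e. dilate r M e \<noteq> {0}} = (\<lambda>d. r * d) ` {d. M d \<noteq> {0}}"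
  proof (intro equalityI subsetI)
    fix e assume e: "e \<in> {e. dilate r M e \<noteq> {0}}"
    then have "r dvd e" by (simp add: dilate_def split: if_splits)
    then obtain d where "e = r * d" by (rule dvdE)
    with e dil show "e \<in> (\<lambda>d. r * d) ` {d. M d \<noteq> {0}}"
      by (intro image_eqI[of _ _ d]) simp_all
  next
    fix e assume "e \<in> (\<lambda>d. r * d) ` {d. M d \<noteq> {0}}"
    then obtain d where "M d \<noteq> {0}" "e = r * d" by blast
    then show "e \<in> {e. dilate r M e \<noteq> {0}}" using dil by simp
  qed
  then have "graded_trace (dilate r M) f q = (\<Sum>e\<in>(\<lambda>d. r * d) ` {d. M d \<noteq> {0}}. q ^ e * [:trace_on (dilate r M e) f:])"
    unfolding graded_trace_def by (rule sum.cong) (rule refl)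
  also have "\<dots> = (\<Sum>d | M d \<noteq> {0}. q ^ (r * d) * [:trace_on (dilate r M (r * d)) f:])"
    using r by (subst sum.reindex) (auto simp: inj_on_def)
  finally show ?thesis
    unfolding dil power_mult by (simp only: graded_trace_def)
qed

lemma homogeneous_basis_dilate:
  assumes r: "r \<ge> 1" and H: "homogeneous_basis M I \<delta> v \<phi>"
  shows "homogeneous_basis (dilate r M) I (\<lambda>i. r * \<delta> i) v \<phi>"
proof -
  have "dilate r M e = complex_vector.span (v ` {i \<in> I. r * \<delta> i = e})" for e
  proof (cases "r dvd e")
    case True
    then obtain d where e: "e = r * d" by blast
    have "{i \<in> I. r * \<delta> i = e} = {i \<in> I. \<delta> i = d}" using r e by auto
    then show ?thesis using H r e by (simp add: dilate_def homogeneous_basis_def)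
  next
    case False
    then have "{i \<in> I. r * \<delta> i = e} = {}" by auto
    then show ?thesis using False by (simp only: dilate_def if_False image_empty complex_vector.span_empty)
  qed
  with H show ?thesis by (simp add: homogeneous_basis_def)
qed

lemma graded_total_dilate:
  assumes "r \<ge> 1" shows "graded_total (dilate r M) = graded_total M"
proof
  have "dilate r M e \<subseteq> graded_total M" for e
    using graded_total_superset[of M "e div r"] complex_vector.span_zero
    by (auto simp: dilate_def graded_total_def)
  then show "graded_total (dilate r M) \<subseteq> graded_total M"
    unfolding graded_total_def[of "dilate r M"] 
    by (intro complex_vector.span_minimal) (auto simp: graded_total_def)
  have "M d \<subseteq> graded_total (dilate r M)" for d
    using graded_total_superset[of "dilate r M" "r * d"] assms by (simp add: dilate_def)
  then show "graded_total M \<subseteq> graded_total (dilate r M)"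
    unfolding graded_total_def[of M] 
    by (intro complex_vector.span_minimal) (auto simp: graded_total_def)
qed

lemma graded_endo_dilate:
  assumes "r \<ge> 1" "graded_endo M f" shows "graded_endo (dilate r M) f"
proof -
  have "f 0 = 0"
  proof -
    have "(0::'a) \<in> graded_total M" by (simp add: graded_total_def complex_vector.span_zero)
    then have "f (0 *\<^sub>C 0) = 0 *\<^sub>C f 0" using assms(2) unfolding graded_endo_def by blast
    then show ?thesis by simp
  qed
  then show ?thesis
    using assms unfolding graded_endo_def graded_total_dilate[OF assms(1)] by (auto simp: dilate_def)
qed

text \<open>The functional \<open>\<phi> \<otimes> \<psi>\<close>: the bilinear map \<open>(a, b) \<mapsto> \<phi>(a) \<psi>(b)\<close> extends to the free space on
  pairs and kills the bilinearity relations, hence descends to the quotient.\<close>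

lemma ex_tensor_functional:
  fixes \<phi> :: "'a::complex_vector \<Rightarrow> complex" and \<psi> :: "'b::complex_vector \<Rightarrow> complex"
  assumes \<phi>: "clinear \<phi>" and \<psi>: "clinear \<psi>"
  shows "\<exists>h :: ('a, 'b) tensor \<Rightarrow> complex. clinear h \<and> (\<forall>a b. h (a \<otimes>\<^sub>t b) = \<phi> a * \<psi> b)"
proof -
  define L where "L = free_lift (\<lambda>(a, b). \<phi> a * \<psi> b)"
  interpret L: Vector_Spaces.linear scaleC scaleC L unfolding L_def by (rule clinear_free_lift)
  have L_single: "L (Poly_Mapping.single (a, b) c) = c * (\<phi> a * \<psi> b)" for a b c
    by (simp add: L_def free_lift_single)
  have "L x = 0" if "x \<in> tensor_relations" for x
    using that unfolding tensor_relations_def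
    by (auto simp: L.diff L.scale L_single complex_vector.linear_add[OF \<phi>] complex_vector.linear_add[OF \<psi>]
        complex_vector.linear_scale[OF \<phi>] complex_vector.linear_scale[OF \<psi>] distrib_left distrib_right mult.left_commute mult.assoc)
  then have L0: "L x = 0" if "x \<in> complex_vector.span tensor_relations" for x
    using that by (rule L.eq_0_on_span)
  have L_cong: "L x = L y" if "tensor_rel x y" for x y
    using L0[of "x - y"] that by (simp add: tensor_rel_def L.diff)
  define h where "h = (\<lambda>x. L (rep_tensor x))"
  have h_abs: "h (abs_tensor x) = L x" for x
    unfolding h_def
    by (intro L_cong Quotient_rep_abs[OF Quotient_tensor] equivp_reflp[OF equivp_tensor_rel])
  have "clinear h"
  proof unfold_locales
    fix x y :: "('a, 'b) tensor" and c :: complex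
    obtain u v where u: "x = abs_tensor u" and v: "y = abs_tensor v"
      using Quotient_abs_rep[OF Quotient_tensor] by metis
    show "h (x + y) = h x + h y"
      unfolding u v by (simp add: plus_tensor.abs_eq h_abs L.add)
    show "h (c *\<^sub>C x) = c *\<^sub>C h x"
      unfolding u by (simp add: scaleC_tensor.abs_eq h_abs L.scale)
  qed
  moreover have "h (a \<otimes>\<^sub>t b) = \<phi> a * \<psi> b" for a b
    by (simp add: pure_tensor.abs_eq h_abs L_single)
  ultimately show ?thesis by blast
qed

lemma pure_tensor_in_span:
  assumes "a \<in> complex_vector.span A" "b \<in> complex_vector.span B"
  shows "a \<otimes>\<^sub>t b \<in> complex_vector.span {a \<otimes>\<^sub>t b | a b. a \<in> A \<and> b \<in> B}" (is "_ \<in> ?S")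
proof -
  have sub: "complex_vector.subspace ?S" by (rule complex_vector.subspace_span)
  have zero: "0 \<otimes>\<^sub>t b = 0" "a \<otimes>\<^sub>t 0 = 0" for a :: 'a and b :: 'b
    using pure_tensor_scale_left[of 0 0 b] pure_tensor_scale_right[of a 0 0] by simp_all
  have "a \<otimes>\<^sub>t b \<in> ?S" if "a \<in> A" for a
  proof (rule complex_vector.span_induct[OF assms(2)])
    show "complex_vector.subspace {b. a \<otimes>\<^sub>t b \<in> ?S}"
      using sub by (auto simp: complex_vector.subspace_def zero pure_tensor_add_right pure_tensor_scale_right)
  qed (use that in \<open>auto intro!: complex_vector.span_base\<close>)
  then show ?thesis
    using sub by (intro complex_vector.span_induct[OF assms(1), where P = "\<lambda>a. a \<otimes>\<^sub>t b \<in> ?S"])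
      (auto simp: complex_vector.subspace_def zero pure_tensor_add_left pure_tensor_scale_left)
qed

lemma homogeneous_basis_tensor:
  assumes H: "homogeneous_basis M I \<delta> v \<phi>" and K: "homogeneous_basis N J \<epsilon> u \<psi>"
  obtains \<chi> where
    "homogeneous_basis (tensor_grading M N) (I \<times> J) (\<lambda>(i, j). \<delta> i + \<epsilon> j) (\<lambda>(i, j). v i \<otimes>\<^sub>t u j) \<chi>"
    and "\<And>i j a b. i \<in> I \<Longrightarrow> j \<in> J \<Longrightarrow> \<chi> (i, j) (a \<otimes>\<^sub>t b) = \<phi> i a * \<psi> j b"
proof -
  have I: "finite I" "finite J"
    and lin: "\<And>i. i \<in> I \<Longrightarrow> clinear (\<phi> i)" "\<And>j. j \<in> J \<Longrightarrow> clinear (\<psi> j)"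
    and M: "\<And>d. M d = complex_vector.span (v ` {i \<in> I. \<delta> i = d})"
    and N: "\<And>d. N d = complex_vector.span (u ` {j \<in> J. \<epsilon> j = d})"
    using H K by (auto simp: homogeneous_basis_def)
  have "\<exists>h. clinear h \<and> (\<forall>a b. h (a \<otimes>\<^sub>t b) = \<phi> (fst p) a * \<psi> (snd p) b)" if "p \<in> I \<times> J" for p
    using that lin by (intro ex_tensor_functional) auto
  then obtain \<chi> where \<chi>: "\<And>p. p \<in> I \<times> J \<Longrightarrow> clinear (\<chi> p)"
      "\<And>p a b. p \<in> I \<times> J \<Longrightarrow> \<chi> p (a \<otimes>\<^sub>t b) = \<phi> (fst p) a * \<psi> (snd p) b"
    by metis
  let ?\<delta> = "\<lambda>(i, j). \<delta> i + \<epsilon> j" and ?v = "\<lambda>(i, j). v i \<otimes>\<^sub>t u j"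
  have "tensor_grading M N d = complex_vector.span (?v ` {p \<in> I \<times> J. ?\<delta> p = d})" (is "_ = ?R") for d
  proof
    have "a \<otimes>\<^sub>t b \<in> ?R" if "i + j = d" "a \<in> M i" "b \<in> N j" for a b i j
    proof -
      have "a \<otimes>\<^sub>t b \<in> complex_vector.span
          {a \<otimes>\<^sub>t b | a b. a \<in> v ` {k \<in> I. \<delta> k = i} \<and> b \<in> u ` {k \<in> J. \<epsilon> k = j}}"
        using that(2,3) unfolding M N by (rule pure_tensor_in_span)
      also have "\<dots> \<subseteq> ?R" by (rule complex_vector.span_mono) (use that(1) in force)
      finally show ?thesis .
    qed
    then show "tensor_grading M N d \<subseteq> ?R" unfolding tensor_grading_def
      by (intro complex_vector.span_minimal) auto
    have "?v ` {p \<in> I \<times> J. ?\<delta> p = d} \<subseteq> {a \<otimes>\<^sub>t b | a b i j. i + j = d \<and> a \<in> M i \<and> b \<in> N j}"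
    proof clarsimp
      fix i j assume "i \<in> I" "j \<in> J" 
      then have "v i \<in> M (\<delta> i)" "u j \<in> N (\<epsilon> j)"
        unfolding M N by (auto intro!: complex_vector.span_base)
      then show "\<exists>a b. v i \<otimes>\<^sub>t u j = a \<otimes>\<^sub>t b \<and> (\<exists>k l. k + l = \<delta> i + \<epsilon> j \<and> a \<in> M k \<and> b \<in> N l)"
        by blast
    qed
    then show "?R \<subseteq> tensor_grading M N d" unfolding tensor_grading_def
      by (rule complex_vector.span_mono)
  qed
  then have "homogeneous_basis (tensor_grading M N) (I \<times> J) ?\<delta> ?v \<chi>"
    unfolding homogeneous_basis_def
  proof (intro conjI ballI)
    fix p p' assume p: "p \<in> I \<times> J" "p' \<in> I \<times> J"
    obtain i j i' j' where ij: "p = (i, j)" "p' = (i', j')" by fastforce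
    show "\<chi> p (case p' of (i, j) \<Rightarrow> v i \<otimes>\<^sub>t u j) = (if p = p' then 1 else 0)"
      using p H K by (simp add: ij \<chi>(2) homogeneous_basis_def)
  qed (use I \<chi>(1) in auto)
  then show ?thesis using \<chi>(2) by (intro that[of \<chi>]) auto
qed

text \<open>On the product basis, the diagonal coefficient of \<open>f \<otimes> g\<close> is the product of those of \<open>f\<close> and
  \<open>g\<close>, and degrees add.\<close>

lemma graded_trace_tensor:
  assumes H: "homogeneous_basis M I \<delta> v \<phi>" and K: "homogeneous_basis N J \<epsilon> u \<psi>"
    and f: "graded_endo M f" and g: "graded_endo N g"
  shows "graded_trace (tensor_grading M N) (tensor_map (graded_total M) (graded_total N) f g) q
       = graded_trace M f q * graded_trace N g q"
proof -
  let ?h = "tensor_map (graded_total M) (graded_total N) f g"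
  have sub: "complex_vector.subspace (graded_total M)" "complex_vector.subspace (graded_total N)"
    by (simp_all add: graded_total_def)
  have h: "clinear ?h" "\<And>a b. a \<in> graded_total M \<Longrightarrow> b \<in> graded_total N \<Longrightarrow> ?h (a \<otimes>\<^sub>t b) = f a \<otimes>\<^sub>t g b"
    by (rule tensor_map_pure[OF sub(1) _ _ sub(2)]; use f g in \<open>simp add: graded_endo_def\<close>)+
  have inM: "a \<in> graded_total M" if "a \<in> M i" for a i using that graded_total_superset by blast
  have inN: "b \<in> graded_total N" if "b \<in> N j" for b j using that graded_total_superset by blast
  have "?h x \<in> tensor_grading M N d" if "x \<in> tensor_grading M N d" for x d
    using that unfolding tensor_grading_def
  proof (induction rule: complex_vector.span_induct_alt)
    case base
    then show ?case by (simp add: complex_vector.linear_0[OF h(1)] complex_vector.span_zero)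
  next
    case (step c x y)
    then obtain a b i j where x: "x = a \<otimes>\<^sub>t b" "i + j = d" "a \<in> M i" "b \<in> N j" by blast
    then have "?h x = f a \<otimes>\<^sub>t g b" "f a \<in> M i" "g b \<in> N j"
      using h(2) inM inN f g by (auto simp: graded_endo_def)
    then have "?h x \<in> complex_vector.span {a \<otimes>\<^sub>t b |a b i j. i + j = d \<and> a \<in> M i \<and> b \<in> N j}"
      using x(2) by (intro complex_vector.span_base) blast
    then show ?case using step
      by (simp add: complex_vector.linear_add[OF h(1)] complex_vector.linear_scale[OF h(1)]
          complex_vector.span_add complex_vector.span_scale)
  qed
  then have endo: "graded_endo (tensor_grading M N) ?h"
    by (simp add: graded_endo_def complex_vector.linear_add[OF h(1)] complex_vector.linear_scale[OF h(1)])
  obtain \<chi> where \<chi>: "homogeneous_basis (tensor_grading M N) (I \<times> J) (\<lambda>(i, j). \<delta> i + \<epsilon> j) (\<lambda>(i, j). v i \<otimes>\<^sub>t u j) \<chi>"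
    "\<And>i j a b. i \<in> I \<Longrightarrow> j \<in> J \<Longrightarrow> \<chi> (i, j) (a \<otimes>\<^sub>t b) = \<phi> i a * \<psi> j b"
    using homogeneous_basis_tensor[OF H K] by metis
  have v: "v i \<in> M (\<delta> i)" if "i \<in> I" for i
    using H that by (auto simp: homogeneous_basis_def intro!: complex_vector.span_base)
  have u: "u j \<in> N (\<epsilon> j)" if "j \<in> J" for j
    using K that by (auto simp: homogeneous_basis_def intro!: complex_vector.span_base)
  have "graded_trace (tensor_grading M N) ?h q
      = (\<Sum>i\<in>I. \<Sum>j\<in>J. q ^ (\<delta> i + \<epsilon> j) * [:\<chi> (i, j) (?h (v i \<otimes>\<^sub>t u j)):])"
    unfolding graded_trace_homogeneous_basis[OF \<chi>(1) endo] sum.cartesian_product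
    by (intro sum.cong) auto
  also have "\<dots> = (\<Sum>i\<in>I. \<Sum>j\<in>J. q ^ \<delta> i * [:\<phi> i (f (v i)):] * (q ^ \<epsilon> j * [:\<psi> j (g (u j)):]))"
    by (intro sum.cong refl) (simp add: h(2)[OF inM[OF v] inN[OF u]] \<chi>(2) power_add mult_ac)
  also have "\<dots> = graded_trace M f q * graded_trace N g q"
    by (simp add: graded_trace_homogeneous_basis[OF H f] graded_trace_homogeneous_basis[OF K g] sum_product)
  finally show ?thesis .
qed

section \<open>The trace on the truncated polynomial ring\<close>

lemma mconst_prod: "mconst (\<Prod>i\<in>A. f i) = (\<Prod>i\<in>A. mconst (f i))"
  by (induction A rule: infinite_finite_induct) simp_all

lemma mconst_sum: "mconst (\<Sum>i\<in>A. f i) = (\<Sum>i\<in>A. mconst (f i))"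
  by (induction A rule: infinite_finite_induct) simp_all

lemma mconst_power: "mconst (c ^ k) = mconst c ^ k"
  by (induction k) simp_all

lemma scaleC_eq_mconst_mult:
  fixes f :: "('x, complex) mpoly"
  shows "c *\<^sub>C f = mconst c * f"
proof (induction f rule: mpoly_induct)
  case (single m a)
  show ?case
    by (rule poly_mapping_eqI) (simp add: mconst_def mult_single lookup_scaleC lookup_single when_def)
qed (simp add: scaleC_add_right distrib_left)

lemma mmonom_mvar: "mmonom mvar m = Poly_Mapping.single m (1 :: 'k::comm_ring_1)"
proof -
  have pow: "(mvar x :: ('x, 'k) mpoly) ^ k = Poly_Mapping.single (Poly_Mapping.single x k) 1" for x and k :: nat
    by (induction k) (simp_all add: mvar_def mult_single flip: single_add)
  have prod: "(\<Prod>x\<in>A. Poly_Mapping.single (h x) (1 :: 'k)) = Poly_Mapping.single (\<Sum>x\<in>A. h x) 1"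
    for A :: "'x set" and h :: "'x \<Rightarrow> 'x \<Rightarrow>\<^sub>0 nat"
    by (induction A rule: infinite_finite_induct) (simp_all add: mult_single)
  have "(\<Sum>x\<in>Poly_Mapping.keys m. Poly_Mapping.single x (Poly_Mapping.lookup m x)) = m"
    by (rule poly_mapping_eqI) (simp add: lookup_sum lookup_single when_def in_keys_iff)
  then show ?thesis by (simp add: mmonom_def pow prod)
qed

text \<open>The exponents of the monomials that span \<open>S\<^sub><\<^sub>r\<close>.\<close>

definition truncated_exponents :: "nat \<Rightarrow> nat \<Rightarrow> (nat \<Rightarrow>\<^sub>0 nat) set" where
  "truncated_exponents r n = {m. Poly_Mapping.keys m \<subseteq> {1..n} \<and> (\<forall>k\<in>{1..n}. Poly_Mapping.lookup m k < r)}"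

abbreviation total_degree :: "nat \<Rightarrow> (nat \<Rightarrow>\<^sub>0 nat) \<Rightarrow> nat" where
  "total_degree n m \<equiv> \<Sum>k=1..n. Poly_Mapping.lookup m k"

lemma finite_truncated_exponents: "finite (truncated_exponents r n)"
proof (rule inj_on_finite)
  let ?f = "\<lambda>m. restrict (Poly_Mapping.lookup m) {1..n}"
  show "?f ` truncated_exponents r n \<subseteq> {1..n} \<rightarrow>\<^sub>E {..<r}" by (auto simp: truncated_exponents_def)
  show "inj_on ?f (truncated_exponents r n)"
  proof (rule inj_onI)
    fix m m' assume m: "m \<in> truncated_exponents r n" "m' \<in> truncated_exponents r n" and eq: "?f m = ?f m'"
    have "Poly_Mapping.lookup m k = Poly_Mapping.lookup m' k" for k
    proof (cases "k \<in> {1..n}")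
      case True
      then show ?thesis using fun_cong[OF eq, of k] by simp
    next
      case False
      then have "k \<notin> Poly_Mapping.keys m" "k \<notin> Poly_Mapping.keys m'" using m unfolding truncated_exponents_def by blast+
      then show ?thesis by (simp add: in_keys_iff)
    qed
    then show "m = m'" by (rule poly_mapping_eqI)
  qed
qed (auto intro: finite_PiE)

lemma homogeneous_basis_truncated_poly:
  "homogeneous_basis (truncated_poly r n) (truncated_exponents r n) (total_degree n)
     (\<lambda>m. Poly_Mapping.single m 1) (\<lambda>m f. Poly_Mapping.lookup f m)"
  unfolding homogeneous_basis_def
proof (intro conjI allI ballI)
  fix d
  show "truncated_poly r n d = complex_vector.span
      ((\<lambda>m. Poly_Mapping.single m 1) ` {m \<in> truncated_exponents r n. total_degree n m = d})"
    unfolding truncated_poly_def truncated_exponents_def by (intro arg_cong[where f = complex_vector.span]) auto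
next
  fix m
  show "clinear (\<lambda>f. Poly_Mapping.lookup f m)"
    by unfold_locales (simp_all add: lookup_add lookup_scaleC)
qed (auto simp: finite_truncated_exponents lookup_single when_def)

text \<open>A group element sends a monomial to a scalar multiple of a monomial; on exponents
  it acts by \<open>m \<mapsto> m \<circ> w\<^sup>-\<^sup>1\<close>. So only the fixed exponents contribute to a trace.\<close>

lemma poly_action_monomial:
  assumes w: "w permutes {1..n}" and m: "Poly_Mapping.keys m \<subseteq> {1..n}"
  shows "poly_action (g, w) (Poly_Mapping.single m 1) =
    (\<Prod>k=1..n. g k ^ Poly_Mapping.lookup m (inv' w k)) *\<^sub>C
      Poly_Mapping.single (Poly_Mapping.map_key (inv' w) m) 1"
proof -
  have inj: "inj (inv' w)" using permutes_inj[OF permutes_inv[OF w]] .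
  let ?m = "Poly_Mapping.map_key (inv' w) m"
  have look: "Poly_Mapping.lookup ?m k = Poly_Mapping.lookup m (inv' w k)" for k
    by (simp add: map_key.rep_eq inj)
  have "inv' w -` Poly_Mapping.keys m \<subseteq> {1..n}"
    using m permutes_in_image[OF permutes_inv[OF w]] by blast
  then have keys: "Poly_Mapping.keys ?m \<subseteq> {1..n}" by (simp add: keys_map_key inj)
  have "poly_action (g, w) (Poly_Mapping.single m 1)
      = (\<Prod>k=1..n. (mconst (g (w k)) * mvar (w k)) ^ Poly_Mapping.lookup m k)"
    using m by (simp add: poly_action_def msubst_single mmonom_superset[of "{1..n}"])
  also have "\<dots> = (\<Prod>k=1..n. (mconst (g k) * mvar k) ^ Poly_Mapping.lookup m (inv' w k))"
    by (subst prod.permute[OF permutes_inv[OF w]]) (simp add: permutes_inverses[OF w])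
  also have "\<dots> = mconst (\<Prod>k=1..n. g k ^ Poly_Mapping.lookup m (inv' w k)) * mmonom mvar ?m"
    by (simp add: power_mult_distrib prod.distrib mconst_prod mconst_power
        mmonom_superset[OF _ keys] look)
  finally show ?thesis by (simp add: scaleC_eq_mconst_mult mmonom_mvar)
qed

lemma graded_endo_poly_action:
  assumes w: "w permutes {1..n}"
  shows "graded_endo (truncated_poly r n) (poly_action (g, w))"
proof -
  have add: "poly_action (g, w) (x + y) = poly_action (g, w) x + poly_action (g, w) y" for x y
    by (simp add: poly_action_def msubst_add)
  have scale: "poly_action (g, w) (c *\<^sub>C x) = c *\<^sub>C poly_action (g, w) x" for c x
    by (simp add: poly_action_def scaleC_eq_mconst_mult msubst_mult msubst_mconst)
  have inj: "inj (inv' w)" using permutes_inj[OF permutes_inv[OF w]] .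
  have "poly_action (g, w) x \<in> truncated_poly r n d" if "x \<in> truncated_poly r n d" for x d
    using that unfolding truncated_poly_def
  proof (induction rule: complex_vector.span_induct_alt)
    case base
    then show ?case using scale[of 0 0] by (simp add: complex_vector.span_zero)
  next
    case (step c x y)
    then obtain m where x: "x = Poly_Mapping.single m 1" and m: "Poly_Mapping.keys m \<subseteq> {1..n}"
      "\<forall>k\<in>{1..n}. Poly_Mapping.lookup m k < r" "total_degree n m = d" by blast
    let ?m = "Poly_Mapping.map_key (inv' w) m"
    have look: "Poly_Mapping.lookup ?m k = Poly_Mapping.lookup m (inv' w k)" for k
      by (simp add: map_key.rep_eq inj)
    have in_n: "inv' w k \<in> {1..n} \<longleftrightarrow> k \<in> {1..n}" for k
      using permutes_in_image[OF permutes_inv[OF w]] .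
    have "Poly_Mapping.keys ?m \<subseteq> {1..n}"
      using m(1) in_n by (auto simp: keys_map_key inj simp del: atLeastAtMost_iff)
    moreover have "\<forall>k\<in>{1..n}. Poly_Mapping.lookup ?m k < r"
      using m(2) in_n by (simp add: look del: atLeastAtMost_iff)
    moreover have "total_degree n ?m = d"
      using sum.permute[OF permutes_inv[OF w], of "Poly_Mapping.lookup m"] m(3) by (simp add: look o_def)
    ultimately show ?case
      unfolding add scale x poly_action_monomial[OF w m(1)]
      by (intro complex_vector.span_add complex_vector.span_scale step.IH complex_vector.span_base) blast
  qed
  then show ?thesis by (simp add: graded_endo_def add scale)
qed

lemma cycles_partition:
  assumes w: "w permutes {1..n}"
  shows finite_cycles: "finite (cycles n w)"
    and cycle_subset: "C \<in> cycles n w \<Longrightarrow> C \<subseteq> {1..n}"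
    and Union_cycles: "\<Union>(cycles n w) = {1..n}"
    and orbit_in_cycle: "\<lbrakk>C \<in> cycles n w; k \<in> C\<rbrakk> \<Longrightarrow> Orbits.orbit w k = C"
    and cycle_nonempty: "C \<in> cycles n w \<Longrightarrow> C \<noteq> {}"
proof -
  show "finite (cycles n w)" by (simp add: cycles_def)
  show sub: "C \<subseteq> {1..n}" if "C \<in> cycles n w" for C
    using that permutes_orbit_subset[OF w] by (auto simp: cycles_def simp del: atLeastAtMost_iff)
  have "permutation w" using w permutation_permutes by blast
  then have self: "k \<in> Orbits.orbit w k" for k by (rule permutation_self_in_orbit)
  then show "\<Union>(cycles n w) = {1..n}" using sub by (fastforce simp: cycles_def)
  show "C \<noteq> {}" if "C \<in> cycles n w" using that self by (auto simp: cycles_def)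
  show "Orbits.orbit w k = C" if "C \<in> cycles n w" "k \<in> C" for C k
    using that orbit_cyclic_eq3[OF cyclic_on_orbit[OF w]] by (auto simp: cycles_def)
qed

lemma prod_over_cycles:
  assumes w: "w permutes {1..n}"
  shows "(\<Prod>k=1..n. f k) = (\<Prod>C\<in>cycles n w. \<Prod>k\<in>C. f k)"
proof -
  have "(\<Prod>k\<in>\<Union>(cycles n w). f k) = (prod \<circ> prod) f (cycles n w)"
  proof (rule prod.Union_disjoint)
    show "\<forall>C\<in>cycles n w. finite C"
      using cycle_subset[OF w] finite_subset by blast
    show "\<forall>C\<in>cycles n w. \<forall>D\<in>cycles n w. C \<noteq> D \<longrightarrow> C \<inter> D = {}"
      using orbit_in_cycle[OF w] by blast
  qed
  then show ?thesis by (simp add: Union_cycles[OF w])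
qed

lemma sum_over_cycles:
  assumes w: "w permutes {1..n}"
  shows "(\<Sum>k=1..n. f k) = (\<Sum>C\<in>cycles n w. \<Sum>k\<in>C. f k)"
proof -
  have "(\<Sum>k\<in>\<Union>(cycles n w). f k) = (sum \<circ> sum) f (cycles n w)"
  proof (rule sum.Union_disjoint)
    show "\<forall>C\<in>cycles n w. finite C"
      using cycle_subset[OF w] finite_subset by blast
    show "\<forall>C\<in>cycles n w. \<forall>D\<in>cycles n w. C \<noteq> D \<longrightarrow> C \<inter> D = {}"
      using orbit_in_cycle[OF w] by blast
  qed
  then show ?thesis by (simp add: Union_cycles[OF w])
qed

text \<open>An exponent fixed by \<open>w\<close> is constant on every cycle, so it is the same as a function that
  assigns to each cycle a number below \<open>r\<close>.\<close>

lemma sum_fixed_monomials: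
  fixes h :: "(nat \<Rightarrow> nat) \<Rightarrow> 'b::comm_monoid_add"
  assumes w: "w permutes {1..n}"
  shows "(\<Sum>m | m \<in> truncated_exponents r n \<and> Poly_Mapping.map_key (inv' w) m = m. h (Poly_Mapping.lookup m)) =
    (\<Sum>c\<in>cycles n w \<rightarrow>\<^sub>E {..<r}. h (\<lambda>k. if k \<in> {1..n} then c (Orbits.orbit w k) else 0))"
proof -
  let ?l = "\<lambda>c k. if k \<in> {1..n} then c (Orbits.orbit w k) else (0::nat)"
  let ?M = "\<lambda>c. Abs_poly_mapping (?l c)"
  have "finite {k. ?l c k \<noteq> 0}" for c by (rule finite_subset[of _ "{1..n}"]) auto
  then have look: "Poly_Mapping.lookup (?M c) = ?l c" for c
    by (rule lookup_Abs_poly_mapping)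
  have inj: "inj (inv' w)" using permutes_inj[OF permutes_inv[OF w]] .
  have fixed_iff: "Poly_Mapping.map_key (inv' w) m = m \<longleftrightarrow>
      (\<forall>k. Poly_Mapping.lookup m (w k) = Poly_Mapping.lookup m k)" for m :: "nat \<Rightarrow>\<^sub>0 nat"
    using permutes_inverses[OF w]
    by (auto simp: poly_mapping_eq_iff fun_eq_iff map_key.rep_eq inj) metis+
  have const: "Poly_Mapping.lookup m k = Poly_Mapping.lookup m l"
    if fix_m: "Poly_Mapping.map_key (inv' w) m = m" and "k \<in> Orbits.orbit w l" for m :: "nat \<Rightarrow>\<^sub>0 nat" and k l
  proof -
    have "Poly_Mapping.lookup m (w j) = Poly_Mapping.lookup m j" for j
      using fix_m unfolding fixed_iff by blast
    with that(2) show ?thesis by (induction rule: orbit.induct) simp_all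
  qed
  have Min: "Min C \<in> C" if "C \<in> cycles n w" for C
    using cycle_nonempty[OF w that] finite_subset[OF cycle_subset[OF w that]] by simp
  have orbit_cycle: "Orbits.orbit w k \<in> cycles n w" if "k \<in> {1..n}" for k
    using that unfolding cycles_def by (rule imageI)
  \<comment> \<open>The value of a fixed exponent on a cycle is read off at the minimum of the cycle; any other
    choice of a representative gives the same value.\<close>
  show ?thesis
  proof (rule sum.reindex_bij_witness[where i = ?M and j = "\<lambda>m. \<lambda>C\<in>cycles n w. Poly_Mapping.lookup m (Min C)"])
    fix m assume "m \<in> {m \<in> truncated_exponents r n. Poly_Mapping.map_key (inv' w) m = m}"
    then have m: "m \<in> truncated_exponents r n" "Poly_Mapping.map_key (inv' w) m = m" by auto
    let ?c = "\<lambda>C\<in>cycles n w. Poly_Mapping.lookup m (Min C)"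
    have eq: "?l ?c k = Poly_Mapping.lookup m k" for k
    proof (cases "k \<in> {1..n}")
      case True
      have "Poly_Mapping.lookup m (Min (Orbits.orbit w k)) = Poly_Mapping.lookup m k"
        by (rule const[OF m(2) Min[OF orbit_cycle[OF True]]])
      then show ?thesis using True orbit_cycle[OF True] by simp
    next
      case False
      then have "k \<notin> Poly_Mapping.keys m" using m(1) unfolding truncated_exponents_def by blast
      then show ?thesis using False by (simp add: in_keys_iff del: atLeastAtMost_iff)
    qed
    show "?M ?c = m" by (rule poly_mapping_eqI) (unfold look, rule eq)
    show "?c \<in> cycles n w \<rightarrow>\<^sub>E {..<r}"
      using Min cycle_subset[OF w] m(1) unfolding truncated_exponents_def by (intro restrict_PiE_iff[THEN iffD2]) blast
    show "h (?l ?c) = h (Poly_Mapping.lookup m)"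
      by (rule arg_cong[where f = h]) (rule ext, rule eq)
  next
    fix c assume c: "c \<in> cycles n w \<rightarrow>\<^sub>E {..<r}"
    have "Poly_Mapping.keys (?M c) \<subseteq> {1..n}" by (auto simp: in_keys_iff look split: if_splits)
    moreover have "Poly_Mapping.lookup (?M c) k < r" if "k \<in> {1..n}" for k
      using PiE_mem[OF c orbit_cycle[OF that]] that by (simp add: look)
    moreover have "Poly_Mapping.lookup (?M c) (w k) = Poly_Mapping.lookup (?M c) k" for k
    proof (cases "k \<in> {1..n}")
      case True
      then have "Orbits.orbit w (w k) = Orbits.orbit w k"
        by (intro orbit_in_cycle[OF w] orbit_cycle orbit.base)
      then show ?thesis by (simp add: look permutes_in_image[OF w] del: atLeastAtMost_iff One_nat_def)
    next
      case False
      then show ?thesis by (simp add: look permutes_in_image[OF w] del: atLeastAtMost_iff One_nat_def)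
    qed
    ultimately show "?M c \<in> {m \<in> truncated_exponents r n. Poly_Mapping.map_key (inv' w) m = m}"
      by (simp add: truncated_exponents_def fixed_iff)
    show "(\<lambda>C\<in>cycles n w. Poly_Mapping.lookup (?M c) (Min C)) = c"
    proof (rule extensionalityI[of _ "cycles n w"])
      fix C assume C: "C \<in> cycles n w"
      have "Min C \<in> {1..n}" using Min[OF C] cycle_subset[OF w C] by blast
      then show "(\<lambda>C\<in>cycles n w. Poly_Mapping.lookup (?M c) (Min C)) C = c C"
        using C orbit_in_cycle[OF w C Min[OF C]] by (simp add: look)
    qed (use c in \<open>auto simp: PiE_def\<close>)
  qed
qed

text \<open>A fixed monomial with exponent \<open>c(C)\<close> on each cycle \<open>C\<close> has degree \<open>\<Sum>\<^sub>C |C| c(C)\<close> and eigenvalue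
  \<open>\<Prod>\<^sub>C g\<^sub>C\<^bsup>c(C)\<^esup>\<close>. The sum over all functions \<open>c\<close> factors over the cycles.\<close>

lemma graded_trace_poly_action:
  assumes w: "w permutes {1..n}"
  shows "graded_trace (truncated_poly r n) (poly_action (g, w)) q =
    (\<Prod>C\<in>cycles n w. \<Sum>c<r. (q ^ card C * [:\<Prod>k\<in>C. g k:]) ^ c)"
proof -
  have const_mult: "[:a * b:] = [:a:] * [:b:]" for a b :: complex
    by simp
  have const_prod: "[:\<Prod>k\<in>A. f k:] = (\<Prod>k\<in>A. [:f k:])" for A and f :: "nat \<Rightarrow> complex"
    by (induction A rule: infinite_finite_induct)
      (simp_all only: prod.infinite prod.empty prod.insert const_mult one_pCons not_False_eq_True)
  have const_power: "[:a ^ k:] = [:a:] ^ k" for a :: complex and k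
    by (induction k) (simp_all only: power_0 power_Suc const_mult one_pCons)
  let ?h = "\<lambda>l. \<Prod>k=1..n. (q * [:g k:]) ^ l k"
  have keys: "Poly_Mapping.keys m \<subseteq> {1..n}" if "m \<in> truncated_exponents r n" for m
    using that by (simp add: truncated_exponents_def)
  have inj: "inj (inv' w)" using permutes_inj[OF permutes_inv[OF w]] .
  have "q ^ total_degree n m * [:Poly_Mapping.lookup (poly_action (g, w) (Poly_Mapping.single m 1)) m:] =
      (if Poly_Mapping.map_key (inv' w) m = m then ?h (Poly_Mapping.lookup m) else 0)"
    if m: "m \<in> truncated_exponents r n" for m
  proof (cases "Poly_Mapping.map_key (inv' w) m = m")
    case True
    then have "Poly_Mapping.lookup m (inv' w k) = Poly_Mapping.lookup m k" for k
      by (metis inj map_key.rep_eq o_apply)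
    then show ?thesis using True
      by (simp add: poly_action_monomial[OF w keys[OF m]] lookup_scaleC power_mult_distrib prod.distrib
          const_prod const_power power_sum[symmetric] del: mult_pCons_left mult_pCons_right)
  next
    case False
    then show ?thesis
      by (simp add: poly_action_monomial[OF w keys[OF m]] lookup_scaleC lookup_single when_def)
  qed
  then have "graded_trace (truncated_poly r n) (poly_action (g, w)) q =
      (\<Sum>m\<in>truncated_exponents r n. if Poly_Mapping.map_key (inv' w) m = m then ?h (Poly_Mapping.lookup m) else 0)"
    unfolding graded_trace_homogeneous_basis[OF homogeneous_basis_truncated_poly graded_endo_poly_action[OF w]]
    by (intro sum.cong) auto
  also have "\<dots> = (\<Sum>m | m \<in> truncated_exponents r n \<and> Poly_Mapping.map_key (inv' w) m = m. ?h (Poly_Mapping.lookup m))"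
    by (rule sum.inter_filter[OF finite_truncated_exponents, symmetric])
  also have "\<dots> = (\<Sum>c\<in>cycles n w \<rightarrow>\<^sub>E {..<r}. \<Prod>C\<in>cycles n w. (q ^ card C * [:\<Prod>k\<in>C. g k:]) ^ c C)"
    unfolding sum_fixed_monomials[OF w, where h = ?h]
  proof (intro sum.cong refl)
    fix c
    have "?h (\<lambda>k. if k \<in> {1..n} then c (Orbits.orbit w k) else 0)
        = (\<Prod>C\<in>cycles n w. \<Prod>k\<in>C. (q * [:g k:]) ^ c (Orbits.orbit w k))"
      unfolding prod_over_cycles[OF w, symmetric] by (intro prod.cong) auto
    also have "\<dots> = (\<Prod>C\<in>cycles n w. (q ^ card C * [:\<Prod>k\<in>C. g k:]) ^ c C)"
    proof (intro prod.cong refl)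
      fix C assume "C \<in> cycles n w"
      then have "(\<Prod>k\<in>C. (q * [:g k:]) ^ c (Orbits.orbit w k)) = (\<Prod>k\<in>C. (q * [:g k:]) ^ c C)"
        by (intro prod.cong) (simp_all add: orbit_in_cycle[OF w])
      also have "\<dots> = (q ^ card C * [:\<Prod>k\<in>C. g k:]) ^ c C"
        unfolding const_prod prod_power_distrib[symmetric] prod.distrib by simp
      finally show "(\<Prod>k\<in>C. (q * [:g k:]) ^ c (Orbits.orbit w k)) = (q ^ card C * [:\<Prod>k\<in>C. g k:]) ^ c C" .
    qed
    finally show "?h (\<lambda>k. if k \<in> {1..n} then c (Orbits.orbit w k) else 0)
        = (\<Prod>C\<in>cycles n w. (q ^ card C * [:\<Prod>k\<in>C. g k:]) ^ c C)" .
  qed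
  also have "\<dots> = (\<Prod>C\<in>cycles n w. \<Sum>c<r. (q ^ card C * [:\<Prod>k\<in>C. g k:]) ^ c)"
    by (rule prod_sum_PiE[symmetric]) (auto simp: finite_cycles[OF w])
  finally show ?thesis .
qed

section \<open>Summation over the colourings\<close>

text \<open>A function on a disjoint union is a family of functions on the blocks, so a sum over such functions
  of a product of terms, each seeing one block only, factors over the blocks.\<close>

lemma sum_PiE_prod_blocks:
  fixes F :: "'a set \<Rightarrow> ('a \<Rightarrow> 'c) \<Rightarrow> 'b::comm_semiring_1"
  assumes P: "finite P" "\<And>C. C \<in> P \<Longrightarrow> finite C" "disjoint P" and G: "finite G"
  shows "(\<Sum>g\<in>\<Union>P \<rightarrow>\<^sub>E G. \<Prod>C\<in>P. F C (restrict g C)) = (\<Prod>C\<in>P. \<Sum>h\<in>C \<rightarrow>\<^sub>E G. F C h)"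
proof -
  \<comment> \<open>The block containing \<open>a\<close>; gluing a family \<open>H\<close> evaluates the member for that block.\<close>
  define cell where "cell = (\<lambda>a. THE C. C \<in> P \<and> a \<in> C)"
  have cell: "cell a = C" if "C \<in> P" "a \<in> C" for a C
    unfolding cell_def using that P(3) by (intro the_equality) (auto dest: disjointD)
  have "(\<Prod>C\<in>P. \<Sum>h\<in>C \<rightarrow>\<^sub>E G. F C h) = (\<Sum>H\<in>PiE P (\<lambda>C. C \<rightarrow>\<^sub>E G). \<Prod>C\<in>P. F C (H C))"
    using P G by (intro prod_sum_PiE finite_PiE)
  also have "\<dots> = (\<Sum>g\<in>\<Union>P \<rightarrow>\<^sub>E G. \<Prod>C\<in>P. F C (restrict g C))"
  proof (rule sum.reindex_bij_witness[where j = "\<lambda>H. \<lambda>a\<in>\<Union>P. H (cell a) a" and i = "\<lambda>g. \<lambda>C\<in>P. restrict g C"])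
    fix g assume g: "g \<in> \<Union>P \<rightarrow>\<^sub>E G"
    show "(\<lambda>C\<in>P. restrict g C) \<in> PiE P (\<lambda>C. C \<rightarrow>\<^sub>E G)" using g by fastforce
    show "(\<lambda>a\<in>\<Union>P. (\<lambda>C\<in>P. restrict g C) (cell a) a) = g"
      using g cell by (intro extensionalityI[of _ "\<Union>P"]) (auto simp: PiE_def)
  next
    fix H assume H: "H \<in> PiE P (\<lambda>C. C \<rightarrow>\<^sub>E G)"
    have HC: "restrict (\<lambda>a\<in>\<Union>P. H (cell a) a) C = H C" if "C \<in> P" for C
      using PiE_mem[OF H that] that cell
      by (intro extensionalityI[of _ C]) (auto simp: PiE_def)
    show "(\<lambda>C\<in>P. restrict (\<lambda>a\<in>\<Union>P. H (cell a) a) C) = H"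
      using H HC by (intro extensionalityI[of _ P]) (auto simp: PiE_def)
    show "(\<lambda>a\<in>\<Union>P. H (cell a) a) \<in> \<Union>P \<rightarrow>\<^sub>E G"
    proof (intro restrict_PiE_iff[THEN iffD2] ballI)
      fix a assume "a \<in> \<Union>P"
      then obtain C where C: "C \<in> P" "a \<in> C" by blast
      then show "H (cell a) a \<in> G" using PiE_mem[OF PiE_mem[OF H C(1)] C(2)] cell[OF C] by simp
    qed
    show "(\<Prod>C\<in>P. F C (restrict (\<lambda>a\<in>\<Union>P. H (cell a) a) C)) = (\<Prod>C\<in>P. F C (H C))"
      using HC by (intro prod.cong) simp_all
  qed
  finally show ?thesis by simp
qed

text \<open>Each value in \<open>\<Gamma>\<close> is the product of the entries of exactly \<open>r\<^bsup>|C| - 1\<^esup>\<close> functions on \<open>C\<close>: all entries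
  but one can be chosen freely.\<close>

lemma sum_PiE_Gamma_prod:
  fixes f :: "complex \<Rightarrow> 'b::comm_semiring_1"
  assumes r: "r \<ge> 1" and C: "finite C" "C \<noteq> {}"
  shows "(\<Sum>h\<in>C \<rightarrow>\<^sub>E carrier (Gamma r). f (\<Prod>a\<in>C. h a)) =
    of_nat (r ^ (card C - 1)) * (\<Sum>z\<in>carrier (Gamma r). f z)"
proof -
  let ?G = "carrier (Gamma r)"
  obtain a B where B: "C = insert a B" "a \<notin> B" "finite B"
    using C by (metis finite_insert mk_disjoint_insert equals0I)
  have "card ?G = r" using r card_roots_unity_eq[of r] by (simp add: Gamma_def)
  then have card: "card (B \<rightarrow>\<^sub>E ?G) = r ^ card B" using B by (simp add: card_PiE)
  have "(\<Sum>h\<in>C \<rightarrow>\<^sub>E ?G. f (\<Prod>a\<in>C. h a)) = (\<Sum>(z, h)\<in>?G \<times> (B \<rightarrow>\<^sub>E ?G). f (\<Prod>b\<in>C. (h(a := z)) b))"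
    unfolding B(1) PiE_insert_eq using B(2)
    by (subst sum.reindex[OF inj_combinator]) (simp_all add: case_prod_unfold)
  also have "\<dots> = (\<Sum>h\<in>B \<rightarrow>\<^sub>E ?G. \<Sum>z\<in>?G. f (\<Prod>b\<in>C. (h(a := z)) b))"
    by (subst sum.swap) (simp add: sum.cartesian_product)
  also have "\<dots> = (\<Sum>h\<in>B \<rightarrow>\<^sub>E ?G. \<Sum>z\<in>?G. f z)"
  proof (rule sum.cong[OF refl])
    fix h assume h: "h \<in> B \<rightarrow>\<^sub>E ?G"
    let ?u = "\<Prod>b\<in>B. h b"
    have "(\<Prod>b\<in>C. (h(a := z)) b) = z * ?u" for z
    proof -
      have "(\<Prod>b\<in>B. (h(a := z)) b) = ?u" using B(2) by (intro prod.cong) auto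
      then show ?thesis using B(2,3) by (simp add: B(1) del: fun_upd_apply) simp
    qed
    moreover have u: "?u ^ r = 1"
      using h by (auto simp: prod_power_distrib Gamma_def PiE_def Pi_def intro: prod.neutral)
    moreover have "(\<Sum>z\<in>?G. f (z * ?u)) = (\<Sum>z\<in>?G. f z)"
    proof -
      have "?u \<noteq> 0" using u r by (auto simp: power_0_left)
      then show ?thesis using u
        by (intro sum.reindex_bij_witness[where j = "\<lambda>z. z * ?u" and i = "\<lambda>z. z * inverse ?u"])
          (simp_all add: Gamma_def power_mult_distrib power_inverse mult.assoc)
    qed
    ultimately show "(\<Sum>z\<in>?G. f (\<Prod>b\<in>C. (h(a := z)) b)) = (\<Sum>z\<in>?G. f z)" by simp
  qed
  also have "\<dots> = of_nat (r ^ (card C - 1)) * (\<Sum>z\<in>?G. f z)"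
    using B card by simp
  finally show ?thesis .
qed

lemma generator_power_bij:
  assumes r: "r \<ge> 1" and \<zeta>: "\<zeta> \<in> carrier (Gamma r)" "generate (Gamma r) {\<zeta>} = carrier (Gamma r)"
  shows "bij_betw (\<lambda>i. \<zeta> ^ i) {..<r} (carrier (Gamma r))"
proof -
  have r1: "\<zeta> ^ r = 1" using \<zeta>(1) by (simp add: Gamma_def)
  then have nz: "\<zeta> \<noteq> 0" using r by (auto simp: power_0_left)
  have *: "a = b" if "a \<le> b" "b < r" "\<zeta> ^ a = \<zeta> ^ b" for a b
  proof -
    have "\<zeta> ^ (b - a) = 1" using that nz by (simp add: power_diff)
    then have "r dvd b - a" using generator_power_eq_1_iff[OF r \<zeta>] by blast
    then show ?thesis using that dvd_imp_le[of r "b - a"] by force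
  qed
  have inj: "inj_on (\<lambda>i. \<zeta> ^ i) {..<r}"
  proof (rule linorder_inj_onI)
    fix a b assume "a < b" "b \<in> {..<r}"
    then show "\<zeta> ^ a \<noteq> \<zeta> ^ b" using *[of a b] by auto
  qed auto
  moreover have "(\<lambda>i. \<zeta> ^ i) ` {..<r} = carrier (Gamma r)"
  proof (rule card_subset_eq)
    show "finite (carrier (Gamma r))"
      using r finite_roots_unity[of r, where 'a = complex] by (simp add: Gamma_def)
    have "(\<zeta> ^ i) ^ r = 1" for i
      by (simp add: r1 power_mult[symmetric] mult.commute[of i]) (simp add: power_mult r1)
    then show "(\<lambda>i. \<zeta> ^ i) ` {..<r} \<subseteq> carrier (Gamma r)"
      by (auto simp: Gamma_def)
    show "card ((\<lambda>i. \<zeta> ^ i) ` {..<r}) = card (carrier (Gamma r))"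
      using r card_roots_unity_eq[of r] card_image[OF inj] by (simp add: Gamma_def)
  qed
  ultimately show ?thesis by (simp add: bij_betw_def)
qed

text \<open>The defining relation of the generators \<open>p\<close>-hat, cleared of its denominator.\<close>

lemma sum_hat_power_sum:
  assumes r: "r \<ge> 1" and \<zeta>: "\<zeta> \<in> carrier (Gamma r)" "generate (Gamma r) {\<zeta>} = carrier (Gamma r)"
    and "j < r"
  shows "(\<Sum>i<r. mconst [:\<zeta> ^ (i * j):] * hat_power_sum r \<zeta> i s) = mconst [:of_nat r:] * mvar (j, s)"
proof -
  have "is_hat_power_sum r \<zeta> s (\<lambda>i. hat_power_sum r \<zeta> i s)"
    using theI'[OF ex1_hat_power_sum[OF r \<zeta>, of s]] unfolding hat_power_sum_def by blast
  then have "mvar (j, s) = mconst [:1 / of_nat r:] * (\<Sum>i<r. mconst [:\<zeta> ^ (i * j):] * hat_power_sum r \<zeta> i s)"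
    using \<open>j < r\<close> unfolding is_hat_power_sum_def by blast
  moreover have "mconst [:of_nat r:] * mconst [:1 / of_nat r :: complex:] = (1 :: wreath_symfun)"
    using r by (simp flip: mconst_hom(4)) (simp add: one_pCons[symmetric])
  ultimately show ?thesis by (simp only: mult.assoc[symmetric] mult_1)
qed

text \<open>The product over colors of products over cycles of that color, written as a product over all
  cycles. The inner product selects the color of a cycle.\<close>

lemma hat_power_sum_tuple_eq:
  assumes w: "w permutes {1..n}"
  shows "hat_power_sum_tuple r \<zeta> (colored_cycle_type n \<zeta> (g, w)) =
    (\<Prod>C\<in>cycles n w. \<Prod>i<r. if (\<Prod>k\<in>C. g k) = \<zeta> ^ i then hat_power_sum r \<zeta> i (card C) else 1)"
proof -
  have "hat_power_sum_tuple r \<zeta> (colored_cycle_type n \<zeta> (g, w)) =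
      (\<Prod>i<r. \<Prod>C | C \<in> cycles n w \<and> (\<Prod>k\<in>C. g k) = \<zeta> ^ i. hat_power_sum r \<zeta> i (card C))"
    by (simp add: hat_power_sum_tuple_def colored_cycle_type_def image_mset.compositionality o_def
        prod_unfold_prod_mset)
  also have "\<dots> = (\<Prod>i<r. \<Prod>C\<in>cycles n w. if (\<Prod>k\<in>C. g k) = \<zeta> ^ i then hat_power_sum r \<zeta> i (card C) else 1)"
    by (intro prod.cong refl prod.inter_filter finite_cycles[OF w])
  finally show ?thesis by (subst prod.swap)
qed

text \<open>This is the place where the two sets of generators meet. The trace contributes the powers
  \<open>\<zeta>\<^bsup>ic\<^esup>\<close> for a cycle of color \<open>i\<close>, and summing these against the \<open>p\<close>-hats over all colors \<open>i\<close> is,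
  up to the factor \<open>r\<close>, the change of generators that produces \<open>p\<^sub>s[X\<^sup>(\<^sup>c\<^sup>)]\<close>.\<close>

lemma sum_colors_cycle:
  assumes r: "r \<ge> 1" and \<zeta>: "\<zeta> \<in> carrier (Gamma r)" "generate (Gamma r) {\<zeta>} = carrier (Gamma r)"
  shows "(\<Sum>z\<in>carrier (Gamma r). mconst (\<Sum>c<r. (tvar ^ s * [:z:]) ^ c) *
       (\<Prod>i<r. if z = \<zeta> ^ i then hat_power_sum r \<zeta> i s else 1)) =
    mconst [:of_nat r:] * (\<Sum>c<r. mconst (tvar ^ (c * s)) * mvar (c, s))"
proof -
  have const_power: "[:a:] ^ k = [:a ^ k:]" for a :: complex and k
    by (induction k) (simp_all add: one_pCons)
  note inj = bij_betw_imp_inj_on[OF generator_power_bij[OF r \<zeta>]]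
  have "(\<Prod>j<r. if \<zeta> ^ i = \<zeta> ^ j then hat_power_sum r \<zeta> j s else 1) = hat_power_sum r \<zeta> i s" if "i < r" for i
  proof -
    have "(\<Prod>j<r. if \<zeta> ^ i = \<zeta> ^ j then hat_power_sum r \<zeta> j s else 1)
        = (\<Prod>j<r. if i = j then hat_power_sum r \<zeta> j s else 1)"
      using that inj by (intro prod.cong refl) (auto dest: inj_onD)
    then show ?thesis using that by simp
  qed
  then have "(\<Sum>z\<in>carrier (Gamma r). mconst (\<Sum>c<r. (tvar ^ s * [:z:]) ^ c) *
       (\<Prod>i<r. if z = \<zeta> ^ i then hat_power_sum r \<zeta> i s else 1)) =
     (\<Sum>i<r. mconst (\<Sum>c<r. (tvar ^ s * [:\<zeta> ^ i:]) ^ c) * hat_power_sum r \<zeta> i s)"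
    by (subst sum.reindex_bij_betw[OF generator_power_bij[OF r \<zeta>], symmetric]) (intro sum.cong, auto)
  also have "\<dots> = (\<Sum>i<r. \<Sum>c<r. mconst (tvar ^ (c * s)) * (mconst [:\<zeta> ^ (i * c):] * hat_power_sum r \<zeta> i s))"
  proof (intro sum.cong refl)
    fix i
    have "(tvar ^ s * [:\<zeta> ^ i:]) ^ c = tvar ^ (c * s) * [:\<zeta> ^ (i * c):]" for c
      by (simp only: power_mult_distrib const_power power_mult[symmetric] mult.commute[of c s])
    then show "mconst (\<Sum>c<r. (tvar ^ s * [:\<zeta> ^ i:]) ^ c) * hat_power_sum r \<zeta> i s =
        (\<Sum>c<r. mconst (tvar ^ (c * s)) * (mconst [:\<zeta> ^ (i * c):] * hat_power_sum r \<zeta> i s))"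
      by (simp only: mconst_sum mconst_hom(4) sum_distrib_right mult.assoc)
  qed
  also have "\<dots> = (\<Sum>c<r. mconst (tvar ^ (c * s)) * (mconst [:of_nat r:] * mvar (c, s)))"
    by (subst sum.swap) (simp add: sum_hat_power_sum[OF r \<zeta>] flip: sum_distrib_left)
  finally show ?thesis by (simp only: sum_distrib_left mult.left_commute)
qed

section \<open>Frobenius images of induced modules\<close>

text \<open>The trace on the induced module splits into that on \<open>S\<^sub><\<^sub>r\<close> and that on the dilation of \<open>M\<close>; the
  dilation by \<open>r\<close> accounts for the parameter \<open>q\<^sup>r\<close>.\<close>

lemma graded_trace_Ind:
  assumes r: "r \<ge> 1" and M: "graded_module (sym_group n) M act" and w: "w permutes {1..n}"
  shows "graded_trace (Ind_grading r n M) (Ind_action r n M act (g, w)) q =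
    (\<Prod>C\<in>cycles n w. \<Sum>c<r. (q ^ card C * [:\<Prod>k\<in>C. g k:]) ^ c) * graded_trace M (act w) (q ^ r)"
proof -
  interpret graded_module "sym_group n" M act by (fact M)
  have "w \<in> carrier (sym_group n)" using w by (simp add: sym_group_carrier)
  then have endo: "graded_endo M (act w)"
    by (auto simp: graded_endo_def intro: act_add act_scale act_graded)
  obtain I \<delta> v \<phi> where H: "homogeneous_basis M (I :: 'a set) \<delta> v \<phi>"
    using ex_homogeneous_basis[OF M] by blast
  show ?thesis
    unfolding Ind_grading_def Ind_action_def snd_conv
      graded_trace_tensor[OF homogeneous_basis_truncated_poly homogeneous_basis_dilate[OF r H]
        graded_endo_poly_action[OF w] graded_endo_dilate[OF r endo]]
      graded_trace_poly_action[OF w] graded_trace_dilate[OF r] ..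
qed

lemma msubst_prod: "msubst s (\<Prod>i\<in>A. f i) = (\<Prod>i\<in>A. msubst s (f i))"
  using msubst_mconst[of s 1] by (induction A rule: infinite_finite_induct) (simp_all add: msubst_mult)

lemma msubst_sum: "msubst s (\<Sum>i\<in>A. f i) = (\<Sum>i\<in>A. msubst s (f i))"
  using msubst_mconst[of s 0] by (induction A rule: infinite_finite_induct) (simp_all add: msubst_add)

lemma wreath_plethysm_power_sum:
  "wreath_plethysm r (power_sum (cycle_type n w)) =
    (\<Prod>C\<in>cycles n w. \<Sum>c<r. mconst (tvar ^ (c * card C)) * mvar (c, card C))"
proof -
  have "power_sum (cycle_type n w) = (\<Prod>C\<in>cycles n w. mvar (card C))"
    by (simp add: power_sum_def cycle_type_def image_mset.compositionality o_def prod_unfold_prod_mset)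
  then show ?thesis by (simp add: wreath_plethysm_def msubst_prod msubst_mvar)
qed

text \<open>The contribution of a fixed permutation \<open>w\<close>. Both the trace and \<open>p\<close>-hat are products over the cycles
  whose factors depend on \<open>g\<close> only through \<open>g\<^sub>C\<close>, so the sum over \<open>g \<in> \<Gamma>\<^sup>n\<close> factors. A cycle
  of length \<open>s\<close> gives \<open>r\<^sup>s\<close> times the plethystic image of \<open>p\<^sub>s\<close>, and the powers of \<open>r\<close> multiply to
  \<open>r\<^sup>n\<close>.\<close>

lemma sum_colorings:
  assumes r: "r \<ge> 1" and \<zeta>: "\<zeta> \<in> carrier (Gamma r)" "generate (Gamma r) {\<zeta>} = carrier (Gamma r)"
    and M: "graded_module (sym_group n) M act" and w: "w permutes {1..n}"
  shows "(\<Sum>g\<in>{1..n} \<rightarrow>\<^sub>E carrier (Gamma r).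
      mconst (graded_trace (Ind_grading r n M) (Ind_action r n M act (g, w)) tvar) *
      hat_power_sum_tuple r \<zeta> (colored_cycle_type n \<zeta> (g, w))) =
    mconst [:of_nat (r ^ n):] * (mconst (graded_trace M (act w) (tvar ^ r)) *
      wreath_plethysm r (power_sum (cycle_type n w)))"
proof -
  let ?G = "carrier (Gamma r)" and ?P = "cycles n w"
  let ?T = "mconst (graded_trace M (act w) (tvar ^ r)) :: wreath_symfun"
  let ?F = "\<lambda>C z. mconst (\<Sum>c<r. (tvar ^ card C * [:z:]) ^ c) *
    (\<Prod>i<r. if z = \<zeta> ^ i then hat_power_sum r \<zeta> i (card C) else 1)"
  let ?X = "\<lambda>C. \<Sum>c<r. mconst (tvar ^ (c * card C)) * mvar (c, card C) :: wreath_symfun"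
  have finG: "finite ?G"
    using r finite_roots_unity[of r, where 'a = complex] by (simp add: Gamma_def)
  have finC: "finite C" if "C \<in> ?P" for C
    using finite_subset[OF cycle_subset[OF w that]] by simp
  have disj: "disjoint ?P"
    using orbit_in_cycle[OF w] by (intro disjointI) blast
  have restr: "(\<Prod>k\<in>C. restrict g C k) = (\<Prod>k\<in>C. g k)" for g :: "nat \<Rightarrow> complex" and C
    by (rule prod.cong) simp_all
  have of_nat: "of_nat k = (mconst [:of_nat k:] :: wreath_symfun)" for k
    by (induction k) (simp_all add: one_pCons flip: mconst_hom)
  have "(\<Sum>g\<in>{1..n} \<rightarrow>\<^sub>E ?G.
      mconst (graded_trace (Ind_grading r n M) (Ind_action r n M act (g, w)) tvar) *
      hat_power_sum_tuple r \<zeta> (colored_cycle_type n \<zeta> (g, w)))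
    = ?T * (\<Sum>g\<in>{1..n} \<rightarrow>\<^sub>E ?G. \<Prod>C\<in>?P. ?F C (\<Prod>k\<in>C. g k))"
    unfolding graded_trace_Ind[OF r M w] hat_power_sum_tuple_eq[OF w] sum_distrib_left prod.distrib
      mconst_hom(4) mconst_prod
    by (simp only: mult_ac)
  also have "(\<Sum>g\<in>{1..n} \<rightarrow>\<^sub>E ?G. \<Prod>C\<in>?P. ?F C (\<Prod>k\<in>C. g k))
      = (\<Prod>C\<in>?P. \<Sum>h\<in>C \<rightarrow>\<^sub>E ?G. ?F C (\<Prod>k\<in>C. h k))"
    using sum_PiE_prod_blocks[OF finite_cycles[OF w] finC disj finG, of "\<lambda>C h. ?F C (\<Prod>k\<in>C. h k)"]
    unfolding Union_cycles[OF w] restr .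
  also have "\<dots> = (\<Prod>C\<in>?P. of_nat (r ^ card C) * ?X C)"
  proof (intro prod.cong refl)
    fix C assume C: "C \<in> ?P"
    have "card C \<noteq> 0" using finC[OF C] cycle_nonempty[OF w C] by simp
    then have pow: "r ^ card C = r ^ (card C - 1) * r" by (cases "card C") simp_all
    have "(\<Sum>h\<in>C \<rightarrow>\<^sub>E ?G. ?F C (\<Prod>k\<in>C. h k)) = of_nat (r ^ (card C - 1)) * (\<Sum>z\<in>?G. ?F C z)"
      by (rule sum_PiE_Gamma_prod[OF r finC[OF C] cycle_nonempty[OF w C]])
    also have "\<dots> = of_nat (r ^ card C) * ?X C"
      unfolding sum_colors_cycle[OF r \<zeta>] of_nat[of r, symmetric] pow of_nat_mult by (simp only: mult.assoc)
    finally show "(\<Sum>h\<in>C \<rightarrow>\<^sub>E ?G. ?F C (\<Prod>k\<in>C. h k)) = of_nat (r ^ card C) * ?X C" .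
  qed
  also have "\<dots> = of_nat (r ^ n) * wreath_plethysm r (power_sum (cycle_type n w))"
  proof -
    have "(\<Prod>C\<in>?P. r ^ card C) = r ^ n"
      using sum_over_cycles[OF w, of "\<lambda>_. 1 :: nat"] by (simp flip: power_sum)
    then show ?thesis
      by (simp only: prod.distrib wreath_plethysm_power_sum flip: of_nat_prod)
  qed
  finally show ?thesis unfolding of_nat by (simp only: mult.left_commute)
qed

theorem proposition9:
  fixes r n :: nat
    and \<zeta> :: complex
    and M :: "nat \<Rightarrow> 'm::complex_vector set"
    and act :: "(nat \<Rightarrow> nat) \<Rightarrow> 'm \<Rightarrow> 'm"
  assumes "r \<ge> 1" and "n \<ge> 1"
    and "\<zeta> \<in> carrier (Gamma r)" and "generate (Gamma r) {\<zeta>} = carrier (Gamma r)"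
    and "graded_module (sym_group n) M act"
  shows "Frob_Gamma r n \<zeta> (Ind_grading r n M) (Ind_action r n M act) tvar =
         wreath_plethysm r (Frob n M act (tvar ^ r))"
proof -
  let ?G = "carrier (Gamma r)" and ?S = "carrier (sym_group n)"
  let ?t = "\<lambda>w. mconst (graded_trace M (act w) (tvar ^ r)) * wreath_plethysm r (power_sum (cycle_type n w))"
  have "card ?G = r" using \<open>r \<ge> 1\<close> card_roots_unity_eq[of r] by (simp add: Gamma_def)
  moreover have "card ?S = fact n" by (simp add: sym_group_def card_permutations)
  ultimately have order: "order (Gamma_wreath r n) = r ^ n * fact n"
    by (simp add: order_def Gamma_wreath_def card_PiE card_cartesian_product)
  have perm: "w permutes {1..n}" if "w \<in> ?S" for w using that by (simp add: sym_group_carrier)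
  have scalar: "mconst [:1 / of_nat (r ^ n * fact n):] * mconst [:of_nat (r ^ n):]
      = (mconst [:1 / fact n:] :: wreath_symfun)"
    using \<open>r \<ge> 1\<close> by (simp flip: mconst_hom(4))
  have "Frob_Gamma r n \<zeta> (Ind_grading r n M) (Ind_action r n M act) tvar
      = mconst [:1 / of_nat (r ^ n * fact n):] * (\<Sum>w\<in>?S. \<Sum>g\<in>{1..n} \<rightarrow>\<^sub>E ?G.
          mconst (graded_trace (Ind_grading r n M) (Ind_action r n M act (g, w)) tvar) *
          hat_power_sum_tuple r \<zeta> (colored_cycle_type n \<zeta> (g, w)))"
    unfolding Frob_Gamma_def order
    by (subst sum.swap) (simp add: Gamma_wreath_def sum.cartesian_product)
  also have "\<dots> = mconst [:1 / of_nat (r ^ n * fact n):] * (\<Sum>w\<in>?S. mconst [:of_nat (r ^ n):] * ?t w)"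
    using sum_colorings[OF assms(1,3,4,5) perm] by simp
  also have "\<dots> = mconst [:1 / fact n:] * (\<Sum>w\<in>?S. ?t w)"
    unfolding scalar[symmetric] by (simp only: sum_distrib_left mult.assoc)
  also have "\<dots> = wreath_plethysm r (Frob n M act (tvar ^ r))"
    by (simp add: Frob_def wreath_plethysm_def msubst_mult msubst_mconst msubst_sum)
  finally show ?thesis .
qed

end
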